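(* Let $E$ be an arbitrary graph and $K$ a field with involution. The following are equivalent: (1) $L_K(E)$ is directly finite; (2) $L_K(E)$ is finite; (3) $E$ is no-exit.
   Context: A (directed) graph $E=(E^0,E^1,\mathbf{s},\mathbf{r})$ has vertex set $E^0$, edge set $E^1$, source and range maps; no finiteness or countability is assumed. A path is a vertex or a sequence $e_1\cdots e_n$ of edges with $\mathbf{r}(e_i)=\mathbf{s}(e_{i+1})$. A cycle is a path $e_1\cdots e_n$ ($n\ge1$) with $\mathbf{s}(e_1)=\mathbf{r}(e_n)$ and $\mathbf{s}(e_i)\ne\mathbf{s}(e_j)$ for $i\ne j$; $E$ is no-exit if $\mathbf{s}^{-1}(v)$ has exactly one element for every vertex $v$ lying on a cycle. A vertex $v$ is regular if $\mathbf{s}^{-1}(v)$ is nonempty and finite. $K$ has an arbitrary involution. $L_K(E)$ is the free $K$-algebra generated by $E^0\cup E^1\cup\{e^*:e\in E^1\}$ subject to (V) $vw=\delta_{v,w}v$; (E1) $\mathbf{s}(e)e=e\mathbf{r}(e)=e$; (E2) $\mathbf{r}(e)e^*=e^*\mathbf{s}(e)=e^*$; (CK1) $e^*f=\delta_{e,f}\mathbf{r}(e)$; (CK2) $v=\sum_{e\in\mathbf{s}^{-1}(v)}ee^*$ for regular $v$; it has involution $(\sum a_ip_iq_i^* )^*=\sum a_i^*q_ip_i^*$ (with $p^*=e_n^*\cdots e_1^*$, $v^*=v$) and has local units. A ring with local units is directly finite if for all $x,y$ and every idempotent $u$ with $xu=ux=x$, $yu=uy=y$, $xy=u$ implies $yx=u$;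 a $*$-ring with local units is finite if for all $x$ and every idempotent $u$ with $xu=ux=x$, $xx^*=u$ implies $x^*x=u$. *)

theory Defs
  imports Main
begin

(* Generators of the free algebra: vertices, real edges, ghost edges e^* *)
datatype ('v, 'e) gen = GV 'v | GE 'e | GG 'e

(* Elements of the free (non-unital) K-algebra on the generators are
   finitely supported K-valued functions on nonempty words. *)
type_synonym ('v, 'e, 'k) fa = "('v, 'e) gen list \<Rightarrow> 'k"

definition gen_ok :: "'v set \<Rightarrow> 'e set \<Rightarrow> ('v, 'e) gen \<Rightarrow> bool" where
  "gen_ok V E x = (case x of GV v \<Rightarrow> v \<in> V | GE e \<Rightarrow> e \<in> E | GG e \<Rightarrow> e \<in> E)"

definition word_ok :: "'v set \<Rightarrow> 'e set \<Rightarrow> ('v, 'e) gen list \<Rightarrow> bool" where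
  "word_ok V E w \<longleftrightarrow> w \<noteq> [] \<and> (\<forall>x\<in>set w. gen_ok V E x)"

definition fa_carrier :: "'v set \<Rightarrow> 'e set \<Rightarrow> ('v, 'e, 'k::zero) fa set" where
  "fa_carrier V E = {f. finite {w. f w \<noteq> 0} \<and> (\<forall>w. f w \<noteq> 0 \<longrightarrow> word_ok V E w)}"

definition fzero :: "('v, 'e, 'k::zero) fa" where "fzero = (\<lambda>_. 0)"
definition fadd :: "('v, 'e, 'k::plus) fa \<Rightarrow> ('v, 'e, 'k) fa \<Rightarrow> ('v, 'e, 'k) fa" where
  "fadd f g = (\<lambda>w. f w + g w)"
definition fsub :: "('v, 'e, 'k::minus) fa \<Rightarrow> ('v, 'e, 'k) fa \<Rightarrow> ('v, 'e, 'k) fa" where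
  "fsub f g = (\<lambda>w. f w - g w)"
definition fscal :: "'k::times \<Rightarrow> ('v, 'e, 'k) fa \<Rightarrow> ('v, 'e, 'k) fa" where
  "fscal c f = (\<lambda>w. c * f w)"
(* product: concatenation of words, bilinearly extended *)
definition fmul :: "('v, 'e, 'k::comm_semiring_1) fa \<Rightarrow> ('v, 'e, 'k) fa \<Rightarrow> ('v, 'e, 'k) fa" where
  "fmul f g = (\<lambda>w. \<Sum>i\<le>length w. f (take i w) * g (drop i w))"
definition mono :: "('v, 'e) gen list \<Rightarrow> ('v, 'e, 'k::zero_neq_one) fa" where
  "mono w = (\<lambda>w'. if w' = w then 1 else 0)"

definition regular :: "'e set \<Rightarrow> ('e \<Rightarrow> 'v) \<Rightarrow> 'v \<Rightarrow> bool" where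
  "regular E s v \<longleftrightarrow> {e \<in> E. s e = v} \<noteq> {} \<and> finite {e \<in> E. s e = v}"

(* The defining relations (V), (E1), (E2), (CK1), (CK2), as elements x - y *)
definition lpa_rels :: "'v set \<Rightarrow> 'e set \<Rightarrow> ('e \<Rightarrow> 'v) \<Rightarrow> ('e \<Rightarrow> 'v) \<Rightarrow> ('v, 'e, 'k::field) fa set" where
  "lpa_rels V E s r =
     {fsub (mono [GV v, GV w]) (if v = w then mono [GV v] else fzero) | v w. v \<in> V \<and> w \<in> V}
   \<union> {fsub (mono [GV (s e), GE e]) (mono [GE e]) | e. e \<in> E}
   \<union> {fsub (mono [GE e, GV (r e)]) (mono [GE e]) | e. e \<in> E}
   \<union> {fsub (mono [GV (r e), GG e]) (mono [GG e]) | e. e \<in> E}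
   \<union> {fsub (mono [GG e, GV (s e)]) (mono [GG e]) | e. e \<in> E}
   \<union> {fsub (mono [GG e, GE f]) (if e = f then mono [GV (r e)] else fzero) | e f. e \<in> E \<and> f \<in> E}
   \<union> {(\<lambda>w. (if w = [GV v] then 1 else 0)
             - (if (\<exists>e. e \<in> E \<and> s e = v \<and> w = [GE e, GG e]) then 1 else 0)) | v.
        v \<in> V \<and> regular E s v}"

inductive_set lpa_ideal :: "'v set \<Rightarrow> 'e set \<Rightarrow> ('e \<Rightarrow> 'v) \<Rightarrow> ('e \<Rightarrow> 'v) \<Rightarrow> ('v, 'e, 'k::field) fa set"
  for V E s r where
  zero: "fzero \<in> lpa_ideal V E s r"
| gen: "\<lbrakk> \<rho> \<in> lpa_rels V E s r; a \<in> fa_carrier V E \<or> a = mono []; b \<in> fa_carrier V E \<or> b = mono [] \<rbrakk>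
        \<Longrightarrow> fmul a (fmul \<rho> b) \<in> lpa_ideal V E s r"
| add: "\<lbrakk> x \<in> lpa_ideal V E s r; y \<in> lpa_ideal V E s r \<rbrakk> \<Longrightarrow> fadd x y \<in> lpa_ideal V E s r"
| scal: "x \<in> lpa_ideal V E s r \<Longrightarrow> fscal c x \<in> lpa_ideal V E s r"

(* equality in L_K(E) = free algebra / ideal *)
definition lpa_eq :: "'v set \<Rightarrow> 'e set \<Rightarrow> ('e \<Rightarrow> 'v) \<Rightarrow> ('e \<Rightarrow> 'v) \<Rightarrow> ('v, 'e, 'k::field) fa \<Rightarrow> ('v, 'e, 'k) fa \<Rightarrow> bool" where
  "lpa_eq V E s r x y \<longleftrightarrow> fsub x y \<in> lpa_ideal V E s r"

definition field_involution :: "('k::field \<Rightarrow> 'k) \<Rightarrow> bool" where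
  "field_involution c \<longleftrightarrow> (\<forall>a b. c (a + b) = c a + c b) \<and> (\<forall>a b. c (a * b) = c a * c b)
     \<and> (\<forall>a. c (c a) = a)"

fun gstar :: "('v, 'e) gen \<Rightarrow> ('v, 'e) gen" where
  "gstar (GV v) = GV v" | "gstar (GE e) = GG e" | "gstar (GG e) = GE e"

definition fstar :: "('k \<Rightarrow> 'k) \<Rightarrow> ('v, 'e, 'k) fa \<Rightarrow> ('v, 'e, 'k) fa" where
  "fstar c f = (\<lambda>w. c (f (rev (map gstar w))))"

definition lpa_directly_finite :: "'v set \<Rightarrow> 'e set \<Rightarrow> ('e \<Rightarrow> 'v) \<Rightarrow> ('e \<Rightarrow> 'v) \<Rightarrow> 'k::field itself \<Rightarrow> bool" where
  "lpa_directly_finite V E s r K \<longleftrightarrow>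
    (\<forall>x\<in>fa_carrier V E. \<forall>y\<in>fa_carrier V E. \<forall>u\<in>fa_carrier V E.
       (lpa_eq V E s r (fmul u u) (u :: ('v,'e,'k) fa)
        \<and> lpa_eq V E s r (fmul x u) x \<and> lpa_eq V E s r (fmul u x) x
        \<and> lpa_eq V E s r (fmul y u) y \<and> lpa_eq V E s r (fmul u y) y
        \<and> lpa_eq V E s r (fmul x y) u)
       \<longrightarrow> lpa_eq V E s r (fmul y x) u)"

definition lpa_finite :: "('k::field \<Rightarrow> 'k) \<Rightarrow> 'v set \<Rightarrow> 'e set \<Rightarrow> ('e \<Rightarrow> 'v) \<Rightarrow> ('e \<Rightarrow> 'v) \<Rightarrow> bool" where
  "lpa_finite c V E s r \<longleftrightarrow>
    (\<forall>x\<in>fa_carrier V E. \<forall>u\<in>fa_carrier V E.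
       (lpa_eq V E s r (fmul u u) (u :: ('v,'e,'k) fa)
        \<and> lpa_eq V E s r (fmul x u) x \<and> lpa_eq V E s r (fmul u x) x
        \<and> lpa_eq V E s r (fmul x (fstar c x)) u)
       \<longrightarrow> lpa_eq V E s r (fmul (fstar c x) x) u)"

definition is_cycle :: "'e set \<Rightarrow> ('e \<Rightarrow> 'v) \<Rightarrow> ('e \<Rightarrow> 'v) \<Rightarrow> 'e list \<Rightarrow> bool" where
  "is_cycle E s r es \<longleftrightarrow> es \<noteq> [] \<and> set es \<subseteq> E
     \<and> (\<forall>i. Suc i < length es \<longrightarrow> r (es ! i) = s (es ! Suc i))
     \<and> s (hd es) = r (last es) \<and> distinct (map s es)"

definition no_exit :: "'v set \<Rightarrow> 'e set \<Rightarrow> ('e \<Rightarrow> 'v) \<Rightarrow> ('e \<Rightarrow> 'v) \<Rightarrow> bool" where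
  "no_exit V E s r \<longleftrightarrow>
     (\<forall>es. is_cycle E s r es \<longrightarrow> (\<forall>v \<in> s ` set es. \<exists>!e. e \<in> E \<and> s e = v))"

end

(*
  (1) => (2): take y = x^*; the involution of the free algebra preserves the defining ideal.

  (2) => (3): if a cycle p based at v has an exit f at v, then x = p^* satisfies x x^* = v, so
  finiteness gives p p^* = v and f = v f = p p^* f = 0. Hence r(f) = f^* f = 0, contradicting the
  representation on boundary paths.

  (3) => (1): a growth argument. If x y = u but w = u - y x is nonzero, the N^2 elements
  y^i w x^j with i, j < N behave like matrix units, hence are linearly independent. They lie in the
  span of the words of length O(N) over finitely many generators. Such words reduce to 0 or to p q^*
  where p and q do not both end with the same edge of a cycle. In a no-exit graph a path is a
  repetition-free path followed by a walk around one cycle, that walk being determined by its end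
  and its length; so there are only O(N) such p q^*.
*)

theory Submission
  imports Defs
begin

section \<open>The algebra of formal series in noncommuting generators\<close>

text \<open>The normal words p q^* are only shown to span, so no basis theorem for L_K(E) is needed.
  Independence is required only of the elements y^i w x^j, and there it follows from their
  multiplication rule. The obstacle is the count. For a single loop e there are about n^2 words made
  of i copies of e and then j copies of e^*, with i, j \<le> n. That is as many as there are matrix
  units, and comparing dimensions would show nothing. In a no-exit graph, however, (CK2) at a vertex
  of a cycle has the single summand e e^*, so a cyclic last edge shared by p and q cancels. Since a
  vertex receives at most one cyclic edge, only one of the two paths then still walks around a
  cycle, and a single free length is left. An arbitrary graph causes no further trouble: x, y and u
  involve finitely many generators, to which only the sources and ranges of their edges must be
  added. The one lower bound on the quotient, that a vertex is not zero, is needed for (2) =>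
  (3).\<close>

typedef ('v, 'e, 'k) ser = "UNIV :: ('v, 'e, 'k) fa set"
  morphisms coeff Ser by simp

lemma coeff_Ser [simp]: "coeff (Ser f) = f"
  by (simp add: Ser_inverse)

lemma Ser_coeff [simp]: "Ser (coeff x) = x"
  by (rule coeff_inverse)

lemma ser_eqI: "(\<And>w. coeff x w = coeff y w) \<Longrightarrow> x = y"
  by (metis Ser_coeff ext)

text \<open>Both sides sum over the cuts of \<open>w\<close> into three consecutive words, indexed
  by the lengths \<open>i\<close> and \<open>k\<close> of the first two.\<close>

lemma fmul_assoc:
  fixes f g h :: "('v, 'e, 'k::field) fa"
  shows "fmul (fmul f g) h = fmul f (fmul g h)"
proof
  fix w :: "('v, 'e) gen list"
  let ?n = "length w"
  let ?t = "\<lambda>i k. f (take i w) * (g (take k (drop i w)) * h (drop (i + k) w))"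
  have "fmul (fmul f g) h w = (\<Sum>m\<le>?n. \<Sum>i\<le>m. ?t i (m - i))"
    unfolding fmul_def
  proof (rule sum.cong[OF refl])
    fix m assume "m \<in> {..?n}"
    then have "length (take m w) = m" by simp
    moreover have "f (take i (take m w)) * g (drop i (take m w)) * h (drop m w) = ?t i (m - i)"
      if "i \<le> m" for i
      using that by (simp add: drop_take min_absorb1 mult.assoc)
    ultimately show "(\<Sum>i\<le>length (take m w). f (take i (take m w)) * g (drop i (take m w))) * h (drop m w)
        = (\<Sum>i\<le>m. ?t i (m - i))"
      by (simp only: sum_distrib_right) (rule sum.cong, simp_all)
  qed
  also have "\<dots> = (\<Sum>(i, k)\<in>{(i, k). i + k \<le> ?n}. ?t i k)"
    by (simp add: sum.triangle_reindex_eq)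
  also have "\<dots> = (\<Sum>(i, k)\<in>(SIGMA i:{..?n}. {..?n - i}). ?t i k)"
    by (rule sum.cong) auto
  also have "\<dots> = (\<Sum>i\<le>?n. \<Sum>k\<le>?n - i. ?t i k)"
    by (simp add: sum.Sigma)
  also have "\<dots> = fmul f (fmul g h) w"
    unfolding fmul_def by (simp add: sum_distrib_left add.commute)
  finally show "fmul (fmul f g) h w = fmul f (fmul g h) w" .
qed

lemma fmul_mono_Nil_left: "fmul (mono []) f = f"
proof
  fix w
  have "fmul (mono []) f w = (\<Sum>i\<le>length w. if i = 0 then f w else 0)"
    unfolding fmul_def mono_def by (rule sum.cong) auto
  then show "fmul (mono []) f w = f w" by simp
qed

lemma fmul_mono_Nil_right: "fmul f (mono []) = f"
proof
  fix w
  have "fmul f (mono []) w = (\<Sum>i\<le>length w. if i = length w then f w else 0)"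
    unfolding fmul_def mono_def by (rule sum.cong) auto
  then show "fmul f (mono []) w = f w" by simp
qed

text \<open>A word has finitely many factorisations into two words, so products make sense without
  finite support. Hence the whole type is a ring in the type-class sense, and the empty word
  supplies the unit that the free algebra lacks. Finite support and admissible generators return
  later through \<open>alg\<close>.\<close>

instantiation ser :: (type, type, field) ring_1
begin

definition "0 = Ser fzero"
definition "1 = Ser (mono [])"
definition "x + y = Ser (fadd (coeff x) (coeff y))"
definition "x - y = Ser (fsub (coeff x) (coeff y))"
definition "- x = Ser (\<lambda>w. - coeff x w)"
definition "x * y = Ser (fmul (coeff x) (coeff y))"

instance
proof
  fix a b c :: "('a, 'b, 'c) ser"
  show "a + b + c = a + (b + c)" "a + b = b + a" "0 + a = a" "- a + a = 0" "a - b = a + - b"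
    by (simp_all add: ser_eqI plus_ser_def minus_ser_def uminus_ser_def zero_ser_def
        fadd_def fsub_def fzero_def add.assoc add.commute)
  show "a * b * c = a * (b * c)" "1 * a = a" "a * 1 = a"
    by (simp_all add: times_ser_def one_ser_def fmul_assoc fmul_mono_Nil_left fmul_mono_Nil_right)
  show "(a + b) * c = a * c + b * c" "a * (b + c) = a * b + a * c"
    by (simp_all add: ser_eqI plus_ser_def times_ser_def fadd_def fmul_def sum.distrib algebra_simps)
  show "(0::('a, 'b, 'c) ser) \<noteq> 1"
  proof
    assume "(0::('a, 'b, 'c) ser) = 1"
    then have "coeff (0::('a, 'b, 'c) ser) [] = coeff 1 []" by simp
    then show False by (simp add: zero_ser_def one_ser_def fzero_def mono_def)
  qed
qed

end

lemma coeff_arith [simp]: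
  "coeff 0 w = 0" "coeff (x + y) w = coeff x w + coeff y w"
  "coeff (x - y) w = coeff x w - coeff y w" "coeff (- x) w = - coeff x w"
  by (simp_all add: zero_ser_def plus_ser_def minus_ser_def uminus_ser_def fzero_def fadd_def fsub_def)

lemma coeff_sum [simp]: "coeff (sum f S) w = (\<Sum>i\<in>S. coeff (f i) w)"
  by (induction S rule: infinite_finite_induct) simp_all

definition scale :: "'k::field \<Rightarrow> ('v, 'e, 'k) ser \<Rightarrow> ('v, 'e, 'k) ser" where
  "scale a x = Ser (fscal a (coeff x))"

lemma coeff_scale [simp]: "coeff (scale a x) w = a * coeff x w"
  by (simp add: scale_def fscal_def)

lemma scale_simps:
  "scale a (scale b x) = scale (a * b) x" "scale a (x + y) = scale a x + scale a y"
  "scale a (x - y) = scale a x - scale a y" "scale (a + b) x = scale a x + scale b x"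
  "scale 0 x = 0" "scale 1 x = x" "scale a 0 = 0"
  by (simp_all add: ser_eqI algebra_simps)

lemma scale_sum: "scale a (sum f S) = (\<Sum>i\<in>S. scale a (f i))"
  and sum_scale: "scale (sum g S) x = (\<Sum>i\<in>S. scale (g i) x)"
  by (simp_all add: ser_eqI sum_distrib_left sum_distrib_right)

lemma scale_mult [simp]: "scale a x * y = scale a (x * y)" "x * scale a y = scale a (x * y)"
  by (simp_all add: ser_eqI times_ser_def fmul_def scale_def fscal_def sum_distrib_left algebra_simps)

definition mon :: "('v, 'e) gen list \<Rightarrow> ('v, 'e, 'k::field) ser" where
  "mon w = Ser (mono w)"

lemma coeff_mon [simp]: "coeff (mon w) w' = (if w' = w then 1 else 0)"
  by (simp add: mon_def mono_def)

lemma mon_Nil: "mon [] = 1"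
  by (simp add: mon_def one_ser_def)

lemma mon_mult [simp]: "mon v * mon w = mon (v @ w)"
proof (rule ser_eqI)
  fix z
  have "coeff (mon v * mon w) z
      = (\<Sum>i\<le>length z. if i = length v then (if z = v @ w then 1 else 0) else (0::'c))"
    unfolding times_ser_def coeff_Ser fmul_def coeff_mon
  proof (rule sum.cong[OF refl])
    fix i assume "i \<in> {..length z}"
    then have "take i z = v \<and> drop i z = w \<longleftrightarrow> i = length v \<and> z = v @ w"
      by (metis append_eq_conv_conj append_take_drop_id atMost_iff length_take min_absorb2)
    moreover have "(if take i z = v then 1 else 0) * (if drop i z = w then 1 else 0)
        = (if take i z = v \<and> drop i z = w then 1 else (0::'c))" by simp
    moreover have "(if i = length v then (if z = v @ w then 1 else 0) else (0::'c))
        = (if i = length v \<and> z = v @ w then 1 else 0)" by simp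
    ultimately show "(if take i z = v then 1 else 0) * (if drop i z = w then 1 else 0)
        = (if i = length v then (if z = v @ w then 1 else 0) else (0::'c))"
      by (simp only:)
  qed
  then show "coeff (mon v * mon w) z = coeff (mon (v @ w) :: ('a, 'b, 'c) ser) z"
    by (auto simp: sum.delta)
qed

section \<open>Supports and finite expansions into words\<close>

definition supp :: "('v, 'e, 'k::field) ser \<Rightarrow> ('v, 'e) gen list set" where
  "supp x = {w. coeff x w \<noteq> 0}"

lemma mon_expansion:
  assumes "finite S" "supp x \<subseteq> S"
  shows "x = (\<Sum>w\<in>S. scale (coeff x w) (mon w))"
  using assms by (intro ser_eqI) (auto simp: supp_def sum.delta' if_distrib cong: if_cong)

lemma supp_mult: "supp (x * y) \<subseteq> (\<lambda>(v, w). v @ w) ` (supp x \<times> supp y)"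
proof
  fix w assume "w \<in> supp (x * y)"
  then have "(\<Sum>i\<le>length w. coeff x (take i w) * coeff y (drop i w)) \<noteq> 0"
    by (simp add: supp_def times_ser_def fmul_def)
  then obtain i where "coeff x (take i w) * coeff y (drop i w) \<noteq> 0"
    by (metis (lifting) sum.neutral)
  then show "w \<in> (\<lambda>(v, w). v @ w) ` (supp x \<times> supp y)"
    by (intro rev_image_eqI[of "(take i w, drop i w)"]) (auto simp: supp_def)
qed

lemma supp_simps:
  "supp (x + y) \<subseteq> supp x \<union> supp y" "supp (x - y) \<subseteq> supp x \<union> supp y"
  "supp (scale a x) \<subseteq> supp x" "supp (mon w :: ('v, 'e, 'k::field) ser) = {w}"
  "supp (0 :: ('v, 'e, 'k::field) ser) = {}"
  by (auto simp: supp_def)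

lemma finite_supp:
  "finite (supp x) \<Longrightarrow> finite (supp y) \<Longrightarrow> finite (supp (x + y))"
  "finite (supp x) \<Longrightarrow> finite (supp y) \<Longrightarrow> finite (supp (x - y))"
  "finite (supp x) \<Longrightarrow> finite (supp y) \<Longrightarrow> finite (supp (x * y))"
  "finite (supp x) \<Longrightarrow> finite (supp (scale a x))"
  by (auto intro: finite_subset[OF supp_simps(1)] finite_subset[OF supp_simps(2)]
      finite_subset[OF supp_simps(3)] finite_subset[OF supp_mult])

subsection \<open>Linear functionals\<close>

text \<open>The linear extension of \<open>h\<close> from words to finitely supported elements. On
  an infinite support \<open>sum\<close> returns 0, so additivity needs finiteness
  hypotheses.\<close>

definition lin :: "(('v, 'e) gen list \<Rightarrow> 'k) \<Rightarrow> ('v, 'e, 'k::field) ser \<Rightarrow> 'k" where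
  "lin h x = (\<Sum>w\<in>supp x. coeff x w * h w)"

lemma lin_eq: "finite S \<Longrightarrow> supp x \<subseteq> S \<Longrightarrow> lin h x = (\<Sum>w\<in>S. coeff x w * h w)"
  unfolding lin_def by (rule sum.mono_neutral_left) (auto simp: supp_def)

lemma lin_mon [simp]: "lin h (mon w) = h w"
  by (simp add: lin_def supp_simps)

lemma lin_0 [simp]: "lin h 0 = 0"
  by (simp add: lin_def supp_simps)

lemma lin_scale [simp]: "lin h (scale a x) = a * lin h x"
proof (cases "a = 0")
  case False
  then have "supp (scale a x) = supp x" by (simp add: supp_def)
  then show ?thesis by (simp add: lin_def sum_distrib_left mult.assoc)
qed (simp add: scale_simps)

lemma lin_add:
  assumes "finite (supp x)" "finite (supp y)"
  shows "lin h (x + y) = lin h x + lin h y"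
proof -
  let ?S = "supp x \<union> supp y"
  have "lin h z = (\<Sum>w\<in>?S. coeff z w * h w)" if "z \<in> {x, y, x + y}" for z
    using that supp_simps(1)[of x y] assms by (intro lin_eq) auto
  then show ?thesis by (simp add: sum.distrib algebra_simps)
qed

lemma lin_diff:
  assumes "finite (supp x)" "finite (supp y)"
  shows "lin h (x - y) = lin h x - lin h y"
  using lin_add[of "x - y" y h] finite_supp(2)[OF assms] assms by simp

lemma finite_supp_sum:
  "(\<And>i. i \<in> I \<Longrightarrow> finite (supp (f i))) \<Longrightarrow> finite (supp (sum f I))"
  by (induction I rule: infinite_finite_induct) (auto simp: supp_simps intro: finite_supp)

lemma lin_sum:
  "(\<And>i. i \<in> I \<Longrightarrow> finite (supp (f i))) \<Longrightarrow> lin h (sum f I) = (\<Sum>i\<in>I. lin h (f i))"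
  by (induction I rule: infinite_finite_induct) (auto simp: lin_add finite_supp_sum)

lemma lin_mon_mult:
  assumes "finite (supp x)"
  shows "lin h (mon v * x * mon w) = lin (\<lambda>z. h (v @ z @ w)) x"
proof -
  have "mon v * x * mon w = (\<Sum>z\<in>supp x. scale (coeff x z) (mon (v @ z @ w)))"
    by (subst mon_expansion[OF assms order_refl]) (simp add: sum_distrib_left sum_distrib_right)
  then show ?thesis
    by (simp add: lin_sum finite_supp supp_simps) (simp add: lin_def)
qed

text \<open>The test for a functional to vanish on a two-sided ideal: generators placed between
  single words suffice, because \<open>a\<close> and \<open>b\<close> are finite combinations of
  words.\<close>

lemma lin_mult_eq_0:
  assumes fin: "finite (supp a)" "finite (supp x)" "finite (supp b)"
    and zero: "\<And>v w. lin (\<lambda>z. h (v @ z @ w)) x = 0"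
  shows "lin h (a * (x * b)) = 0"
proof -
  have "a * (x * b) = (\<Sum>v\<in>supp a. scale (coeff a v) (mon v))
      * (x * (\<Sum>w\<in>supp b. scale (coeff b w) (mon w)))"
    using mon_expansion[OF fin(1) order_refl] mon_expansion[OF fin(3) order_refl] by simp
  then have "a * (x * b) = (\<Sum>v\<in>supp a. \<Sum>w\<in>supp b. scale (coeff a v * coeff b w) (mon v * x * mon w))"
    by (simp add: sum_distrib_left sum_distrib_right scale_sum scale_simps mult.assoc)
      (subst sum.swap, simp add: mult.commute)
  then show ?thesis
    using fin by (simp add: lin_sum finite_supp_sum finite_supp supp_simps lin_mon_mult zero)
qed

section \<open>Homogeneous linear systems\<close>

text \<open>Gaussian elimination with unknowns \<open>T\<close> and equations \<open>B\<close>. Each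
  equation is either void or is spent on eliminating one unknown, the pivot
  \<open>t0\<close>.\<close>

lemma homogeneous_system_nontrivial:
  fixes M :: "'t \<Rightarrow> 'b \<Rightarrow> 'k::field"
  assumes "finite B" "finite T" "card B < card T"
  shows "\<exists>a. (\<exists>t\<in>T. a t \<noteq> 0) \<and> (\<forall>b\<in>B. (\<Sum>t\<in>T. a t * M t b) = 0)"
  using assms
proof (induction B arbitrary: T M rule: finite_induct)
  case empty
  then have "T \<noteq> {}" by auto
  then show ?case by (intro exI[of _ "\<lambda>_. 1"]) auto
next
  case (insert b B)
  show ?case
  proof (cases "\<forall>t\<in>T. M t b = 0")
    case True
    have "card B < card T" using insert by simp
    from insert.IH[OF insert.prems(1) this, of M] True show ?thesis by auto
  next
    case False
    then obtain t0 where t0: "t0 \<in> T" "M t0 b \<noteq> 0" by auto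
    define T' where "T' = T - {t0}"
    define q where "q t = M t b / M t0 b" for t
    have T: "finite T'" "t0 \<notin> T'" "T = insert t0 T'"
      using insert.prems t0 by (auto simp: T'_def)
    then have "card B < card T'" using insert by simp
    from insert.IH[OF T(1) this, of "\<lambda>t b'. M t b' - q t * M t0 b'"] obtain a where
      a: "\<exists>t\<in>T'. a t \<noteq> 0" "\<And>b'. b' \<in> B \<Longrightarrow> (\<Sum>t\<in>T'. a t * (M t b' - q t * M t0 b')) = 0"
      by blast
    \<comment> \<open>Back-substitution: the pivot unknown gets the value that solves equation
      \<open>b\<close>. The other equations then agree with the reduced ones.\<close>
    define a' where "a' t = (if t = t0 then - (\<Sum>t\<in>T'. a t * q t) else a t)" for t
    have sum: "(\<Sum>t\<in>T. a' t * M t b') = (\<Sum>t\<in>T'. a t * (M t b' - q t * M t0 b'))" for b'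
    proof -
      have "(\<Sum>t\<in>T. a' t * M t b') = a' t0 * M t0 b' + (\<Sum>t\<in>T'. a' t * M t b')"
        using T by simp
      also have "(\<Sum>t\<in>T'. a' t * M t b') = (\<Sum>t\<in>T'. a t * M t b')"
        using T by (intro sum.cong) (auto simp: a'_def)
      finally show ?thesis
        by (simp add: a'_def algebra_simps sum_subtractf sum_distrib_left)
    qed
    have "(\<Sum>t\<in>T. a' t * M t b') = 0" if "b' \<in> insert b B" for b'
      using that a(2) t0 by (auto simp: sum q_def)
    moreover have "\<exists>t\<in>T. a' t \<noteq> 0" using a(1) T by (auto simp: a'_def)
    ultimately show ?thesis by blast
  qed
qed

section \<open>Cycles in a graph\<close>

locale graph =
  fixes V :: "'v set" and E :: "'e set" and s r :: "'e \<Rightarrow> 'v"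
  assumes source: "e \<in> E \<Longrightarrow> s e \<in> V" and range: "e \<in> E \<Longrightarrow> r e \<in> V"
begin

definition reach :: "('v \<times> 'v) set" where
  "reach = {(s e, r e) | e. e \<in> E}\<^sup>*"

text \<open>The edges lying on a closed path, possibly with repeated vertices. Reachability makes
  this easy to establish; \<open>cyclic_imp_cycle\<close> recovers a genuine cycle.\<close>

definition cyclic :: "'e \<Rightarrow> bool" where
  "cyclic e \<longleftrightarrow> e \<in> E \<and> (r e, s e) \<in> reach"

lemma reach_refl [simp]: "(v, v) \<in> reach"
  by (simp add: reach_def)

lemma reach_trans: "(u, v) \<in> reach \<Longrightarrow> (v, w) \<in> reach \<Longrightarrow> (u, w) \<in> reach"
  by (auto simp: reach_def)

lemma reach_edge: "e \<in> E \<Longrightarrow> (s e, r e) \<in> reach"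
  by (auto simp: reach_def)

lemma reach_induct [consumes 1, case_names base step]:
  assumes "(u, w) \<in> reach" "P w"
    and "\<And>e. e \<in> E \<Longrightarrow> (r e, w) \<in> reach \<Longrightarrow> P (r e) \<Longrightarrow> P (s e)"
  shows "P u"
  using assms(1) unfolding reach_def
  by (induction rule: converse_rtrancl_induct) (use assms(2,3) in \<open>auto simp: reach_def\<close>)

definition closed_walk :: "'e list \<Rightarrow> bool" where
  "closed_walk es \<longleftrightarrow> es \<noteq> [] \<and> set es \<subseteq> E \<and> successively (\<lambda>a b. r a = s b) es \<and> r (last es) = s (hd es)"

lemma cyclic_imp_closed_walk:
  assumes "cyclic e"
  shows "\<exists>es. closed_walk es \<and> hd es = e"
proof -
  \<comment> \<open>Induction backwards along a path from \<open>v\<close> to \<open>s e\<close>;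
    the empty list stands for the trivial path at \<open>s e\<close>.\<close>
  have "\<exists>es. set es \<subseteq> E \<and> successively (\<lambda>a b. r a = s b) es
      \<and> (if es = [] then v = s e else s (hd es) = v \<and> r (last es) = s e)"
    if "(v, s e) \<in> reach" for v
    using that
  proof (induction rule: reach_induct)
    case base
    show ?case by (intro exI[of _ "[]"]) simp
  next
    case (step f)
    then obtain es where "set es \<subseteq> E" "successively (\<lambda>a b. r a = s b) es"
      "if es = [] then r f = s e else s (hd es) = r f \<and> r (last es) = s e" by blast
    then show ?case using step(1)
      by (intro exI[of _ "f # es"]) (auto simp: successively_Cons split: if_splits)
  qed
  from this[of "r e"] obtain es where "set es \<subseteq> E" "successively (\<lambda>a b. r a = s b) es"
    "if es = [] then r e = s e else s (hd es) = r e \<and> r (last es) = s e"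
    using assms by (auto simp: cyclic_def)
  then show ?thesis using assms
    by (intro exI[of _ "e # es"]) (auto simp: closed_walk_def cyclic_def successively_Cons split: if_splits)
qed

text \<open>Cuts out the closed subwalk between two visits to the same source, so that a closed walk
  can be shortened.\<close>

lemma successively_take_drop:
  assumes "successively (\<lambda>a b. r a = s b) es" "i < j" "j < length es" "s (es ! i) = s (es ! j)"
  shows "successively (\<lambda>a b. r a = s b) (take i es @ drop j es)"
proof -
  let ?P = "\<lambda>a b. r a = s b"
  have "successively ?P (take i es)" "successively ?P (drop j es)"
    using assms(1) successively_append_iff[of ?P "take i es" "drop i es"]
      successively_append_iff[of ?P "take j es" "drop j es"] by simp_all
  moreover have "r (last (take i es)) = s (hd (drop j es))" if "i \<noteq> 0"
  proof -
    have "r (es ! (i - 1)) = s (es ! i)"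
      using assms that successively_nth[OF assms(1), of "i - 1"] by simp
    moreover have "last (take i es) = es ! (i - 1)"
      using assms that by (subst last_conv_nth) auto
    ultimately show ?thesis using assms by (simp add: hd_drop_conv_nth)
  qed
  ultimately show ?thesis by (auto simp: successively_append_iff)
qed

text \<open>A shortest closed walk that starts with \<open>e\<close> has distinct sources.\<close>

lemma cyclic_imp_cycle:
  assumes "cyclic e"
  shows "\<exists>es. is_cycle E s r es \<and> e \<in> set es"
proof -
  let ?Q = "\<lambda>es. closed_walk es \<and> hd es = e"
  obtain es0 where "?Q es0" using cyclic_imp_closed_walk[OF assms] by blast
  from ex_has_least_nat[of ?Q, OF this, of length]
  obtain es where es: "?Q es" and min: "\<And>es'. ?Q es' \<Longrightarrow> length es \<le> length es'"
    by blast
  have walk: "successively (\<lambda>a b. r a = s b) es" "es \<noteq> []" "set es \<subseteq> E" "r (last es) = s e" "es ! 0 = e"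
    using es by (auto simp: closed_walk_def hd_conv_nth)
  have "False" if "i < j" "j < length es" "s (es ! i) = s (es ! j)" for i j
  \<comment> \<open>For \<open>i = 0\<close>, cutting out the subwalk would remove \<open>e\<close>
    itself, so the subwalk is kept instead and the rest discarded.\<close>
  proof (cases "i = 0")
    case True
    have "r (es ! (j - 1)) = s (es ! j)"
      using successively_nth[OF walk(1), of "j - 1"] that by simp
    moreover have "last (take j es) = es ! (j - 1)"
      using that by (subst last_conv_nth) auto
    moreover have "s (es ! j) = s e" using that True walk(5) by simp
    ultimately have "r (last (take j es)) = s e" by (simp only:)
    moreover have "successively (\<lambda>a b. r a = s b) (take j es)"
      using walk(1) successively_append_iff[of "\<lambda>a b. r a = s b" "take j es" "drop j es"] by simp
    moreover have "hd (take j es) = e" "take j es \<noteq> []" using es that walk(2) by auto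
    moreover have "set (take j es) \<subseteq> E" using walk(3) set_take_subset[of j es] by blast
    ultimately have "?Q (take j es)" by (simp add: closed_walk_def)
    from min[OF this] show False using that by simp
  next
    case False
    let ?es = "take i es @ drop j es"
    have "successively (\<lambda>a b. r a = s b) ?es"
      using successively_take_drop[OF walk(1) that] .
    moreover have "hd ?es = e" "last ?es = last es" "?es \<noteq> []"
      using that False es walk(2) by auto
    moreover have "set ?es \<subseteq> E"
      using walk(3) set_take_subset[of i es] set_drop_subset[of j es] by auto
    ultimately have "?Q ?es" using walk(4) by (simp add: closed_walk_def)
    from min[OF this] show False using that by simp
  qed
  then have "distinct (map s es)"
    unfolding distinct_conv_nth by (metis length_map linorder_neqE_nat nth_map)
  moreover have "r (es ! i) = s (es ! Suc i)" if "Suc i < length es" for i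
    using successively_nth[OF walk(1) that] .
  ultimately have "is_cycle E s r es"
    unfolding is_cycle_def using es walk(2-4) by metis
  moreover have "e \<in> set es" using es by (auto simp: closed_walk_def)
  ultimately show ?thesis by blast
qed

end

section \<open>Cyclic edges in a no-exit graph\<close>

locale no_exit_graph = graph V E s r
  for V :: "'v set" and E :: "'e set" and s r :: "'e \<Rightarrow> 'v" +
  assumes no_exit: "no_exit V E s r"
begin

lemma cyclic_unique:
  assumes "cyclic e" "f \<in> E" "s f = s e"
  shows "f = e"
proof -
  obtain es where "is_cycle E s r es" "e \<in> set es"
    using cyclic_imp_cycle[OF assms(1)] by blast
  then have "\<exists>!g. g \<in> E \<and> s g = s e"
    using no_exit by (auto simp: no_exit_def)
  moreover have "e \<in> E" using assms(1) by (simp add: cyclic_def)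
  ultimately show ?thesis using assms(2,3) by blast
qed

text \<open>The return path from \<open>r e\<close> to \<open>s e\<close> is empty or starts with an
  edge \<open>g\<close>, which is cyclic too. As cyclic edges share their source with no other edge,
  \<open>f\<close> is \<open>e\<close> in the first case and \<open>g\<close> in the second.\<close>

lemma cyclic_next:
  assumes "cyclic e" "f \<in> E" "s f = r e"
  shows "cyclic f"
proof -
  have "(r e, s e) \<in> reach" using assms by (simp add: cyclic_def)
  then have "r e = s e \<or> (\<exists>g\<in>E. s g = r e \<and> (r g, s e) \<in> reach)"
    by (cases rule: converse_rtranclE[OF \<open>(r e, s e) \<in> reach\<close>[unfolded reach_def]]) (auto simp: reach_def)
  then show ?thesis
  proof
    assume "r e = s e"
    then show ?thesis using assms cyclic_unique by metis
  next
    assume "\<exists>g\<in>E. s g = r e \<and> (r g, s e) \<in> reach"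
    then obtain g where g: "g \<in> E" "s g = r e" "(r g, s e) \<in> reach" by blast
    then have "cyclic g"
      using assms reach_edge[of e] by (auto simp: cyclic_def intro: reach_trans)
    then show ?thesis using cyclic_unique[of g f] assms g by simp
  qed
qed

text \<open>On cyclic edges this is the step around the cycle. It depends on \<open>e\<close> only
  through \<open>r e\<close>, which is what \<open>cyclic_unique_range\<close> exploits.\<close>

definition succ_edge :: "'e \<Rightarrow> 'e" where
  "succ_edge e = (SOME f. f \<in> E \<and> s f = r e)"

lemma succ_edge_eq:
  assumes "cyclic e" "f \<in> E" "s f = r e"
  shows "succ_edge e = f"
proof -
  have "succ_edge e \<in> E \<and> s (succ_edge e) = r e"
    unfolding succ_edge_def by (rule someI[of _ f]) (use assms in simp)
  then show ?thesis
    using cyclic_unique[OF cyclic_next[OF assms], of "succ_edge e"] assms(3) by simp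
qed

text \<open>The quantified \<open>e\<close> is the edge through which the path enters
  \<open>v\<close>, so it changes along the induction. The exponent is a successor so that
  \<open>f = e\<close> yields a positive period.\<close>

lemma succ_edge_reach:
  assumes "(v, s f) \<in> reach" "cyclic f"
  shows "\<forall>e. cyclic e \<longrightarrow> r e = v \<longrightarrow> (\<exists>k. (succ_edge ^^ Suc k) e = f)"
  using assms(1)
proof (induction rule: reach_induct)
  case base
  then show ?case
    using assms(2) succ_edge_eq[of _ f] by (intro allI impI exI[of _ 0]) (simp add: cyclic_def)
next
  case (step g)
  show ?case
  proof (intro allI impI)
    fix e assume e: "cyclic e" "r e = s g"
    then have "succ_edge e = g" "cyclic g"
      using step(1) succ_edge_eq[of e g] cyclic_next[of e g] by simp_all
    moreover then obtain k where "(succ_edge ^^ Suc k) g = f" using step.IH by blast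
    ultimately have "(succ_edge ^^ Suc (Suc k)) e = f"
      by (simp add: funpow_swap1)
    then show "\<exists>k. (succ_edge ^^ Suc k) e = f" by blast
  qed
qed

lemma funpow_fixed_mult: "(f ^^ n) x = x \<Longrightarrow> (f ^^ (n * m)) x = x"
  by (induction m) (simp_all add: funpow_add)

text \<open>Both edges are periodic under \<open>succ_edge\<close>, and they have the same
  successor. Iterating that successor one step short of a common period returns to \<open>e\<close>
  and to \<open>f\<close> alike.\<close>

lemma cyclic_unique_range:
  assumes "cyclic e" "cyclic f" "r e = r f"
  shows "e = f"
proof -
  obtain k l where "(succ_edge ^^ Suc k) e = e" "(succ_edge ^^ Suc l) f = f"
    using succ_edge_reach[of "r e" e] succ_edge_reach[of "r f" f] assms unfolding cyclic_def by blast
  then have "(succ_edge ^^ (Suc k * Suc l)) e = e" "(succ_edge ^^ (Suc k * Suc l)) f = f"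
    using funpow_fixed_mult[of "Suc k" succ_edge e "Suc l"] funpow_fixed_mult[of "Suc l" succ_edge f "Suc k"]
    by (simp_all add: mult.commute del: funpow.simps mult_Suc mult_Suc_right)
  moreover obtain m where "Suc k * Suc l = Suc m" by simp
  moreover have "succ_edge e = succ_edge f" using assms(3) by (simp add: succ_edge_def)
  ultimately show ?thesis by (metis comp_apply funpow_Suc_right)
qed

end

section \<open>Pairs of paths with a common range\<close>

context graph
begin

text \<open>Paths are stored with their last edge first, so that the common range of a pair of paths
  sits at the heads of the lists.\<close>

primrec rpath :: "'e list \<Rightarrow> 'v \<Rightarrow> bool" where
  "rpath [] v \<longleftrightarrow> True"
| "rpath (e # p) v \<longleftrightarrow> e \<in> E \<and> r e = v \<and> rpath p (s e)"

primrec start :: "'e list \<Rightarrow> 'v \<Rightarrow> 'v" where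
  "start [] v = v"
| "start (e # p) v = start p (s e)"

lemma start_append [simp]: "start (p @ q) v = start q (start p v)"
  by (induction p arbitrary: v) auto

lemma rpath_append [simp]: "rpath (p @ q) v \<longleftrightarrow> rpath p v \<and> rpath q (start p v)"
  by (induction p arbitrary: v) auto

lemma rpath_subset: "rpath p v \<Longrightarrow> set p \<subseteq> E"
  by (induction p arbitrary: v) auto

lemma rpath_reach: "rpath p v \<Longrightarrow> e \<in> set p \<Longrightarrow> (r e, v) \<in> reach"
proof (induction p arbitrary: v)
  case (Cons f p)
  show ?case
  proof (cases "e = f")
    case False
    then have "(r e, s f) \<in> reach" using Cons by simp
    then show ?thesis using Cons.prems reach_edge[of f] by (auto intro: reach_trans)
  qed (use Cons in simp)
qed simp

text \<open>An edge that occurs twice on a path lies on a closed path, hence is cyclic.\<close>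

lemma rpath_noncyclic_distinct:
  "rpath p v \<Longrightarrow> (\<forall>e\<in>set p. \<not> cyclic e) \<Longrightarrow> distinct p"
proof (induction p arbitrary: v)
  case (Cons e p)
  then have "e \<notin> set p"
    using rpath_reach[of p "s e" e] by (auto simp: cyclic_def)
  then show ?case using Cons by auto
qed simp

text \<open>A triple stands for the element p q^*. The common range \<open>v\<close> is recorded
  because both paths may be empty.\<close>

definition triples :: "'e set \<Rightarrow> 'v set \<Rightarrow> nat \<Rightarrow> ('e list \<times> 'v \<times> 'e list) set" where
  "triples F W n = {(p, v, q). v \<in> W \<and> set p \<subseteq> F \<and> set q \<subseteq> F \<and> rpath p v \<and> rpath q v
     \<and> length p \<le> n \<and> length q \<le> n}"

definition normal :: "'e set \<Rightarrow> 'v set \<Rightarrow> nat \<Rightarrow> ('e list \<times> 'v \<times> 'e list) set" where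
  "normal F W n = {(p, v, q) \<in> triples F W n. \<not> (\<exists>e p' q'. p = e # p' \<and> q = e # q' \<and> cyclic e)}"

end

context no_exit_graph
begin

text \<open>By \<open>cyclic_next\<close> a path that enters a cycle stays on it up to its last
  edge, which is \<open>hd p\<close> in the reversed storage.\<close>

lemma rpath_cyclic: "rpath p v \<Longrightarrow> e \<in> set p \<Longrightarrow> cyclic e \<Longrightarrow> cyclic (hd p)"
proof (induction p arbitrary: v)
  case (Cons f p)
  show ?case
  proof (cases "e = f")
    case False
    then obtain g p' where p: "p = g # p'" using Cons.prems by (cases p) auto
    then have "cyclic g" using Cons False by fastforce
    then show ?thesis using cyclic_next[of g f] Cons.prems p by simp
  qed (use Cons in simp)
qed simp

text \<open>\<open>takeWhile cyclic\<close> removes the final walk around a cycle. The rest is empty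
  or its head is not cyclic, so by \<open>rpath_cyclic\<close> it contains no cyclic edge and hence
  no repetition.\<close>

lemma dropWhile_cyclic:
  assumes "rpath p v"
  shows "distinct (dropWhile cyclic p)"
proof -
  let ?q = "dropWhile cyclic p"
  have q: "rpath ?q (start (takeWhile cyclic p) v)"
    using assms rpath_append[of "takeWhile cyclic p" ?q v] by simp
  have "\<not> cyclic e" if "e \<in> set ?q" for e
    using rpath_cyclic[OF q that] hd_dropWhile[of cyclic p] that by fastforce
  then show ?thesis using rpath_noncyclic_distinct[OF q] by blast
qed

text \<open>Read backwards from \<open>v\<close>, each cyclic edge is forced by its range.\<close>

lemma cyclic_rpath_unique:
  assumes "rpath p v" "rpath q v" "\<forall>e\<in>set p. cyclic e" "\<forall>e\<in>set q. cyclic e" "length p = length q"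
  shows "p = q"
  using assms
proof (induction p arbitrary: q v)
  case (Cons e p)
  then obtain f q' where q: "q = f # q'" by (cases q) auto
  then have "e = f" using Cons.prems cyclic_unique_range[of e f] by simp
  then show ?case using Cons.IH[of "s e" q'] Cons.prems q by simp
qed simp

text \<open>Given \<open>v\<close>, a path is determined by its noncyclic part, one of finitely many
  repetition-free lists over \<open>F\<close>, and by the length of its cyclic part. If both cyclic
  parts of a triple were nonempty, their last edges would be cyclic with range \<open>v\<close>,
  hence equal, against normality.\<close>

lemma card_normal:
  assumes "finite F" "finite W"
  shows "\<exists>C. \<forall>n. finite (normal F W n) \<and> card (normal F W n) \<le> C * Suc n"
proof -
  define D where "D = {p. set p \<subseteq> F \<and> distinct p}"
  have "D \<subseteq> {p. set p \<subseteq> F \<and> length p \<le> card F}"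
    using assms(1) by (auto simp: D_def distinct_card[symmetric] intro: card_mono)
  then have D: "finite D" using finite_lists_length_le[OF assms(1)] finite_subset by blast
  define f where "f = (\<lambda>(p, v :: 'v, q). (v, dropWhile cyclic p, dropWhile cyclic q,
      length (takeWhile cyclic p), length (takeWhile cyclic q)))"
  have inj: "inj_on f (normal F W n)" for n
  proof (rule inj_onI)
    have *: "p = q" if "rpath p v" "rpath q v" "dropWhile cyclic p = dropWhile cyclic q"
        "length (takeWhile cyclic p) = length (takeWhile cyclic q)" for p q v
    proof -
      have "rpath (takeWhile cyclic z) v" if "rpath z v" for z
        using that rpath_append[of "takeWhile cyclic z" "dropWhile cyclic z" v] by simp
      then have "takeWhile cyclic p = takeWhile cyclic q"
        using that by (intro cyclic_rpath_unique) (auto dest: set_takeWhileD)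
      then show ?thesis using that(3) takeWhile_dropWhile_id by metis
    qed
    fix x y assume "x \<in> normal F W n" "y \<in> normal F W n" "f x = f y"
    then show "x = y"
      by (auto simp: f_def normal_def triples_def intro: *)
  qed
  \<comment> \<open>The last factor consists of two coordinate axes instead of a square, since one
    cyclic part is empty. This makes the bound linear in \<open>n\<close>.\<close>
  define I where "I n = W \<times> D \<times> D \<times> ({0} \<times> {..n} \<union> {..n} \<times> {0::nat})" for n
  have sub: "f ` normal F W n \<subseteq> I n" for n
  proof
    fix x assume "x \<in> f ` normal F W n"
    then obtain p v q where x: "x = f (p, v, q)" and t: "(p, v, q) \<in> normal F W n" by auto
    then have pq: "v \<in> W" "set p \<subseteq> F" "set q \<subseteq> F" "rpath p v" "rpath q v" "length p \<le> n" "length q \<le> n"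
      by (auto simp: normal_def triples_def)
    have "takeWhile cyclic p = [] \<or> takeWhile cyclic q = []"
    proof (rule ccontr)
      assume "\<not> ?thesis"
      then obtain e p' g q' where eg: "p = e # p'" "q = g # q'" "cyclic e" "cyclic g"
        by (cases p; cases q) (auto split: if_splits)
      then have "e = g" using pq cyclic_unique_range[of e g] by simp
      then show False using t eg by (auto simp: normal_def)
    qed
    moreover have "length (takeWhile cyclic p) \<le> n" "length (takeWhile cyclic q) \<le> n"
      using pq le_trans length_takeWhile_le by blast+
    moreover have "dropWhile cyclic p \<in> D" "dropWhile cyclic q \<in> D"
      using pq dropWhile_cyclic by (auto simp: D_def dest: set_dropWhileD)
    ultimately show "x \<in> I n"
      using pq(1) by (auto simp: x f_def I_def)
  qed
  have fin: "finite (I n)" for n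
    using D assms by (simp add: I_def)
  have "card ({0} \<times> {..n} \<union> {..n} \<times> {0::nat}) \<le> 2 * Suc n" for n
    by (rule order_trans[OF card_Un_le]) (simp add: card_cartesian_product)
  then have "card (I n) \<le> card W * (card D * (card D * (2 * Suc n)))" for n
    by (simp add: I_def card_cartesian_product del: mult_Suc_right)
  then have "finite (normal F W n) \<and> card (normal F W n) \<le> (card W * card D * card D * 2) * Suc n" for n
    using inj_on_finite[OF inj sub fin] card_inj_on_le[OF inj sub fin, of n]
    by (metis (no_types, lifting) mult.assoc order_trans)
  then show ?thesis by blast
qed

end

section \<open>The defining ideal\<close>

locale lpa = graph V E s r
  for V :: "'v set" and E :: "'e set" and s r :: "'e \<Rightarrow> 'v" +
  fixes K :: "'k::field itself"
begin

definition alg :: "('v, 'e, 'k) ser set" where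
  "alg = Ser ` fa_carrier V E"

definition ideal :: "('v, 'e, 'k) ser set" where
  "ideal = Ser ` lpa_ideal V E s r"

text \<open>Equality in L_K(E), kept as a congruence; no quotient is formed. Multiplication is
  compatible with it for multipliers from \<open>insert 1 alg\<close>; a product with an infinite
  series may leave \<open>ideal\<close>.\<close>

definition eqv :: "('v, 'e, 'k) ser \<Rightarrow> ('v, 'e, 'k) ser \<Rightarrow> bool" (infix "\<approx>" 50) where
  "x \<approx> y \<longleftrightarrow> x - y \<in> ideal"

lemma Ser_in_ideal: "Ser x \<in> ideal \<longleftrightarrow> x \<in> lpa_ideal V E s r"
  unfolding ideal_def by (metis coeff_Ser imageE imageI)

lemma lpa_eq_iff: "lpa_eq V E s r x y \<longleftrightarrow> Ser x \<approx> Ser y"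
  by (simp add: lpa_eq_def eqv_def minus_ser_def Ser_in_ideal)

lemma alg_iff: "x \<in> alg \<longleftrightarrow> finite (supp x) \<and> (\<forall>w\<in>supp x. word_ok V E w)"
proof -
  have "x \<in> alg \<longleftrightarrow> coeff x \<in> fa_carrier V E"
    unfolding alg_def by (metis Ser_coeff coeff_Ser imageE imageI)
  then show ?thesis by (simp add: fa_carrier_def supp_def)
qed

lemma alg_mult: "x \<in> alg \<Longrightarrow> y \<in> alg \<Longrightarrow> x * y \<in> alg"
  using supp_mult[of x y] unfolding alg_iff
  by (fastforce simp: finite_supp word_ok_def)

lemma alg_diff: "x \<in> alg \<Longrightarrow> y \<in> alg \<Longrightarrow> x - y \<in> alg"
  using supp_simps(2)[of x y] unfolding alg_iff by (auto simp: finite_supp)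

text \<open>\<open>insert 1 alg\<close> is a multiplicative monoid and no subspace, which is enough
  for multipliers. It mirrors the option \<open>mono []\<close> in \<open>lpa_ideal\<close>.\<close>

lemma alg1_mult: "x \<in> insert 1 alg \<Longrightarrow> y \<in> insert 1 alg \<Longrightarrow> x * y \<in> insert 1 alg"
  by (auto simp: alg_mult)

lemma alg1_power: "x \<in> alg \<Longrightarrow> x ^ n \<in> insert 1 alg"
  by (induction n) (auto simp: alg_mult)

lemma alg1_mult_alg: "x \<in> insert 1 alg \<Longrightarrow> y \<in> alg \<Longrightarrow> x * y \<in> alg"
  by (auto simp: alg_mult)

lemma alg_mult_alg1: "x \<in> alg \<Longrightarrow> y \<in> insert 1 alg \<Longrightarrow> x * y \<in> alg"
  by (auto simp: alg_mult)

lemma ideal_0 [simp]: "0 \<in> ideal"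
  by (simp add: zero_ser_def Ser_in_ideal lpa_ideal.zero)

lemma ideal_add: "x \<in> ideal \<Longrightarrow> y \<in> ideal \<Longrightarrow> x + y \<in> ideal"
  unfolding ideal_def by (auto simp: plus_ser_def intro: lpa_ideal.add)

lemma ideal_scale: "x \<in> ideal \<Longrightarrow> scale a x \<in> ideal"
  unfolding ideal_def by (auto simp: scale_def intro: lpa_ideal.scal)

lemma ideal_uminus: "x \<in> ideal \<Longrightarrow> - x \<in> ideal"
  using ideal_scale[of x "- 1"] ser_eqI[of "- x" "scale (- 1) x"] by simp

lemma ideal_diff: "x \<in> ideal \<Longrightarrow> y \<in> ideal \<Longrightarrow> x - y \<in> ideal"
  using ideal_add[of x "- y"] ideal_uminus[of y] by simp

lemma ideal_sum: "(\<And>i. i \<in> I \<Longrightarrow> f i \<in> ideal) \<Longrightarrow> sum f I \<in> ideal"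
  by (induction I rule: infinite_finite_induct) (auto intro: ideal_add)

lemma ideal_induct [consumes 1, case_names zero gen add scale]:
  assumes "x \<in> ideal" "P 0"
    and "\<And>\<rho> a b. \<rho> \<in> lpa_rels V E s r \<Longrightarrow> a \<in> insert 1 alg \<Longrightarrow> b \<in> insert 1 alg \<Longrightarrow> P (a * (Ser \<rho> * b))"
    and "\<And>x y. x \<in> ideal \<Longrightarrow> y \<in> ideal \<Longrightarrow> P x \<Longrightarrow> P y \<Longrightarrow> P (x + y)"
    and "\<And>a x. x \<in> ideal \<Longrightarrow> P x \<Longrightarrow> P (scale a x)"
  shows "P x"
proof -
  have "P (Ser f)" if "f \<in> lpa_ideal V E s r" for f
    using that
  proof induction
    case zero
    then show ?case using assms(2) by (simp add: zero_ser_def)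
  next
    case (gen \<rho> a b)
    then have "Ser a \<in> insert 1 alg" "Ser b \<in> insert 1 alg"
      by (auto simp: alg_def one_ser_def)
    from assms(3)[OF gen(1) this] show ?case by (simp add: times_ser_def)
  next
    case (add x y)
    then show ?case
      using assms(4)[of "Ser x" "Ser y"] by (simp add: plus_ser_def Ser_in_ideal)
  next
    case (scal x a)
    then show ?case
      using assms(5)[of "Ser x" a] by (simp add: scale_def Ser_in_ideal)
  qed
  then show ?thesis using assms(1) by (auto simp: ideal_def)
qed

lemma ideal_gen:
  assumes "\<rho> \<in> lpa_rels V E s r" "a \<in> insert 1 alg" "b \<in> insert 1 alg"
  shows "a * (Ser \<rho> * b) \<in> ideal"
proof -
  have "coeff x \<in> fa_carrier V E \<or> coeff x = mono []" if "x \<in> insert 1 alg" for x :: "('v, 'e, 'k) ser"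
    using that by (auto simp: alg_def one_ser_def)
  then show ?thesis
    using assms by (auto simp: times_ser_def Ser_in_ideal intro!: lpa_ideal.gen)
qed

lemma ideal_rel: "\<rho> \<in> lpa_rels V E s r \<Longrightarrow> Ser \<rho> \<in> ideal"
  using ideal_gen[of \<rho> 1 1] by simp

lemma ideal_mult_left:
  assumes "x \<in> ideal" "a \<in> insert 1 alg"
  shows "a * x \<in> ideal"
  using assms(1)
proof (induction rule: ideal_induct)
  case (gen \<rho> a' b)
  then show ?case
    using ideal_gen[OF gen(1) alg1_mult[OF assms(2) gen(2)] gen(3)] by (simp only: mult.assoc)
qed (auto simp: distrib_left ideal_add ideal_scale)

lemma ideal_mult_right:
  assumes "x \<in> ideal" "b \<in> insert 1 alg"
  shows "x * b \<in> ideal"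
  using assms(1)
proof (induction rule: ideal_induct)
  case (gen \<rho> a b')
  then show ?case
    using ideal_gen[OF gen(1,2) alg1_mult[OF gen(3) assms(2)]] by (simp only: mult.assoc)
qed (auto simp: distrib_right ideal_add ideal_scale)

lemma eqv_refl [simp]: "x \<approx> x"
  by (simp add: eqv_def)

lemma eqv_sym: "x \<approx> y \<Longrightarrow> y \<approx> x"
  using ideal_uminus[of "x - y"] by (simp add: eqv_def)

lemma eqv_trans [trans]: "x \<approx> y \<Longrightarrow> y \<approx> z \<Longrightarrow> x \<approx> z"
  using ideal_add[of "x - y" "y - z"] by (simp add: eqv_def)

lemma eqv_0_iff: "x \<approx> 0 \<longleftrightarrow> x \<in> ideal"
  by (simp add: eqv_def)

lemma eqv_diff: "x \<approx> x' \<Longrightarrow> y \<approx> y' \<Longrightarrow> x - y \<approx> x' - y'"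
  using ideal_diff[of "x - x'" "y - y'"] by (simp add: eqv_def algebra_simps)

lemma eqv_scale: "x \<approx> y \<Longrightarrow> scale a x \<approx> scale a y"
  using ideal_scale[of "x - y" a] by (simp add: eqv_def scale_simps)

lemma eqv_sum: "(\<And>i. i \<in> I \<Longrightarrow> f i \<approx> g i) \<Longrightarrow> sum f I \<approx> sum g I"
  using ideal_sum[of I "\<lambda>i. f i - g i"] by (simp add: eqv_def sum_subtractf)

lemma eqv_left: "x \<approx> y \<Longrightarrow> a \<in> insert 1 alg \<Longrightarrow> a * x \<approx> a * y"
  using ideal_mult_left[of "x - y" a] by (simp add: eqv_def right_diff_distrib)

lemma eqv_right: "x \<approx> y \<Longrightarrow> a \<in> insert 1 alg \<Longrightarrow> x * a \<approx> y * a"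
  using ideal_mult_right[of "x - y" a] by (simp add: eqv_def left_diff_distrib)

lemma Ser_fsub: "Ser (fsub f g) = Ser f - Ser g"
  by (simp add: minus_ser_def)

text \<open>At most one edge \<open>e\<close> fits a given word \<open>w\<close>, so the indicator
  in the relation is a sum of indicators, finite by regularity.\<close>

lemma Ser_CK2:
  assumes "regular E s v"
  shows "Ser (\<lambda>w. (if w = [GV v] then 1 else 0)
        - (if (\<exists>e. e \<in> E \<and> s e = v \<and> w = [GE e, GG e]) then 1 else 0))
      = mon [GV v] - (\<Sum>e | e \<in> E \<and> s e = v. mon [GE e, GG e] :: ('v, 'e, 'k) ser)"
proof (rule ser_eqI)
  fix w :: "('v, 'e) gen list"
  have fin: "finite {e \<in> E. s e = v}" using assms by (simp add: regular_def)
  have "(if \<exists>e. e \<in> E \<and> s e = v \<and> w = [GE e, GG e] then 1 else 0 :: 'k)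
      = (\<Sum>e | e \<in> E \<and> s e = v. if w = [GE e, GG e] then 1 else 0)"
  proof (cases "\<exists>e. e \<in> E \<and> s e = v \<and> w = [GE e, GG e]")
    case True
    then obtain e where e: "e \<in> E" "s e = v" "w = [GE e, GG e]" by blast
    then show ?thesis using fin by (auto simp: sum.delta)
  next
    case False
    then show ?thesis by (auto intro!: sum.neutral[symmetric])
  qed
  then show "coeff (Ser (\<lambda>w. (if w = [GV v] then 1 else 0)
        - (if (\<exists>e. e \<in> E \<and> s e = v \<and> w = [GE e, GG e]) then 1 else 0))) w
      = coeff (mon [GV v] - (\<Sum>e | e \<in> E \<and> s e = v. mon [GE e, GG e] :: ('v, 'e, 'k) ser)) w"
    by simp
qed

lemma lpa_rels_cases [consumes 1, case_names V E1s E1r E2r E2s CK1 CK2]: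
  fixes \<rho> :: "('v, 'e, 'k) fa"
  assumes "\<rho> \<in> lpa_rels V E s r"
  obtains v w where "v \<in> V" "w \<in> V" "Ser \<rho> = mon [GV v, GV w] - (if v = w then mon [GV v] else 0)"
  | e where "e \<in> E" "Ser \<rho> = mon [GV (s e), GE e] - mon [GE e]"
  | e where "e \<in> E" "Ser \<rho> = mon [GE e, GV (r e)] - mon [GE e]"
  | e where "e \<in> E" "Ser \<rho> = mon [GV (r e), GG e] - mon [GG e]"
  | e where "e \<in> E" "Ser \<rho> = mon [GG e, GV (s e)] - mon [GG e]"
  | e f where "e \<in> E" "f \<in> E" "Ser \<rho> = mon [GG e, GE f] - (if e = f then mon [GV (r e)] else 0)"
  | v where "v \<in> V" "regular E s v" "Ser \<rho> = mon [GV v] - (\<Sum>e | e \<in> E \<and> s e = v. mon [GE e, GG e])"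
  using assms unfolding lpa_rels_def Un_iff mem_Collect_eq
  apply (elim disjE exE conjE)
  subgoal for v w by (cases "v = w"; rule that(1)[of v w]; simp only: Ser_fsub mon_def zero_ser_def[symmetric] if_True if_False refl)
  subgoal for e by (rule that(2)[of e]; simp only: Ser_fsub mon_def zero_ser_def[symmetric] if_True if_False refl)
  subgoal for e by (rule that(3)[of e]; simp only: Ser_fsub mon_def zero_ser_def[symmetric] if_True if_False refl)
  subgoal for e by (rule that(4)[of e]; simp only: Ser_fsub mon_def zero_ser_def[symmetric] if_True if_False refl)
  subgoal for e by (rule that(5)[of e]; simp only: Ser_fsub mon_def zero_ser_def[symmetric] if_True if_False refl)
  subgoal for e f by (cases "e = f"; rule that(6)[of e f]; simp only: Ser_fsub mon_def zero_ser_def[symmetric] if_True if_False refl)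
  subgoal for v by (rule that(7)[of v]; simp only: Ser_CK2)
  done

lemma rel_fsub: "fsub f g \<in> lpa_rels V E s r \<Longrightarrow> Ser f \<approx> Ser g"
  using ideal_rel[of "fsub f g"] by (simp add: eqv_def Ser_fsub)

lemma rel_V:
  assumes "v \<in> V" "w \<in> V"
  shows "mon [GV v, GV w] \<approx> (if v = w then mon [GV v] else 0)"
proof -
  have "fsub (mono [GV v, GV w]) (if v = w then mono [GV v] else fzero) \<in> lpa_rels V E s r"
    unfolding lpa_rels_def using assms by blast
  from rel_fsub[OF this] show ?thesis by (simp add: mon_def zero_ser_def[symmetric] split: if_splits)
qed

lemma rel_E:
  assumes "e \<in> E"
  shows rel_E1s: "mon [GV (s e), GE e] \<approx> mon [GE e]"
    and rel_E1r: "mon [GE e, GV (r e)] \<approx> mon [GE e]"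
    and rel_E2r: "mon [GV (r e), GG e] \<approx> mon [GG e]"
    and rel_E2s: "mon [GG e, GV (s e)] \<approx> mon [GG e]"
  unfolding mon_def using assms by (intro rel_fsub; unfold lpa_rels_def; blast)+

lemma rel_CK1:
  assumes "e \<in> E" "f \<in> E"
  shows "mon [GG e, GE f] \<approx> (if e = f then mon [GV (r e)] else 0)"
proof -
  have "fsub (mono [GG e, GE f]) (if e = f then mono [GV (r e)] else fzero) \<in> lpa_rels V E s r"
    unfolding lpa_rels_def using assms by blast
  from rel_fsub[OF this] show ?thesis by (simp add: mon_def zero_ser_def[symmetric] split: if_splits)
qed

lemma rel_CK2:
  assumes "v \<in> V" "regular E s v"
  shows "mon [GV v] \<approx> (\<Sum>e | e \<in> E \<and> s e = v. mon [GE e, GG e])"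
proof -
  have "(\<lambda>w. (if w = [GV v] then 1 else 0)
        - (if (\<exists>e. e \<in> E \<and> s e = v \<and> w = [GE e, GG e]) then 1 else 0 :: 'k)) \<in> lpa_rels V E s r"
    unfolding lpa_rels_def using assms by blast
  from ideal_rel[OF this] show ?thesis using Ser_CK2[OF assms(2)] by (simp add: eqv_def)
qed

subsection \<open>Rewriting words modulo the ideal\<close>

definition gens_ok :: "('v, 'e) gen list \<Rightarrow> bool" where
  "gens_ok w \<longleftrightarrow> (\<forall>g\<in>set w. gen_ok V E g)"

lemma gens_ok_simps [simp]:
  "gens_ok []" "gens_ok (g # w) \<longleftrightarrow> gen_ok V E g \<and> gens_ok w"
  "gens_ok (w @ w') \<longleftrightarrow> gens_ok w \<and> gens_ok w'"
  "gens_ok (map GE p) \<longleftrightarrow> set p \<subseteq> E" "gens_ok (map GG p) \<longleftrightarrow> set p \<subseteq> E"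
  "gen_ok V E (GV v) \<longleftrightarrow> v \<in> V" "gen_ok V E (GE e) \<longleftrightarrow> e \<in> E" "gen_ok V E (GG e) \<longleftrightarrow> e \<in> E"
  by (auto simp: gens_ok_def gen_ok_def)

lemma mon_alg1: "gens_ok w \<Longrightarrow> mon w \<in> insert 1 alg"
  by (cases "w = []") (auto simp: mon_Nil alg_iff supp_simps word_ok_def gens_ok_def)

lemma mon_replace:
  assumes "mon x \<approx> y" "gens_ok a" "gens_ok b"
  shows "mon (a @ x @ b) \<approx> mon a * y * mon b"
proof -
  have "mon a * mon x * mon b \<approx> mon a * y * mon b"
    using assms by (intro eqv_right eqv_left mon_alg1)
  then show ?thesis by simp
qed

lemma mon_replace_word: "mon x \<approx> mon y \<Longrightarrow> gens_ok a \<Longrightarrow> gens_ok b \<Longrightarrow> mon (a @ x @ b) \<approx> mon (a @ y @ b)"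
  using mon_replace[of x "mon y" a b] by simp

lemma mon_replace_0: "mon x \<approx> 0 \<Longrightarrow> gens_ok a \<Longrightarrow> gens_ok b \<Longrightarrow> mon (a @ x @ b) \<approx> 0"
  using mon_replace[of x 0 a b] by simp

text \<open>The word p v q^*; the vertex in the middle keeps it nonempty. The stored order of
  \<open>q\<close> is already the order of the ghost edges, so only \<open>p\<close> is
  reversed.\<close>

definition tword :: "'e list \<Rightarrow> 'v \<Rightarrow> 'e list \<Rightarrow> ('v, 'e) gen list" where
  "tword p v q = map GE (rev p) @ [GV v] @ map GG q"

lemma tword_start:
  assumes "rpath p v" "rpath q v" "v \<in> V"
  shows "mon (tword p v q @ [GV (start q v)]) \<approx> mon (tword p v q)"
proof (cases q rule: rev_cases)
  case Nil
  have "mon [GV v, GV v] \<approx> mon [GV v]" using rel_V[of v v] assms by simp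
  from mon_replace_word[OF this, of "map GE (rev p)" "[]"] show ?thesis
    using Nil rpath_subset[OF assms(1)] by (simp add: tword_def)
next
  case (snoc q' e)
  then have "e \<in> E" using assms by simp
  from mon_replace_word[OF rel_E2s[OF this], of "map GE (rev p) @ [GV v] @ map GG q'" "[]"]
  show ?thesis
    using snoc rpath_subset[OF assms(1)] rpath_subset[OF assms(2)] assms by (simp add: tword_def)
qed

lemma gens_ok_tword: "rpath p v \<Longrightarrow> rpath q v \<Longrightarrow> v \<in> V \<Longrightarrow> gens_ok (tword p v q)"
  using rpath_subset by (simp add: tword_def)


end

context lpa
begin

lemma start_in_V: "rpath q v \<Longrightarrow> v \<in> V \<Longrightarrow> start q v \<in> V"
  by (induction q arbitrary: v) (auto intro: source)

lemma tword_start_append: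
  assumes "rpath p v" "rpath q v" "v \<in> V" "gens_ok b"
  shows "mon (tword p v q @ b) \<approx> mon (tword p v q @ GV (start q v) # b)"
  using eqv_sym[OF eqv_right[OF tword_start[OF assms(1-3)] mon_alg1[OF assms(4)]]] by simp

text \<open>\<open>start q v\<close> acts as a right unit on the word. Inserting it before
  \<open>GV w\<close> produces a product of two distinct vertices, which (V) kills.\<close>

lemma tword_kill:
  assumes "rpath p v" "rpath q v" "v \<in> V" "gens_ok (GV w # b)" "w \<noteq> start q v"
  shows "mon (tword p v q @ GV w # b) \<approx> 0"
proof -
  have "mon (tword p v q @ GV w # b) \<approx> mon (tword p v q @ GV (start q v) # GV w # b)"
    using tword_start_append assms by blast
  also have "\<dots> \<approx> 0"
  proof -
    have "mon [GV (start q v), GV w] \<approx> 0"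
      using rel_V[of "start q v" w] start_in_V assms by simp
    from mon_replace_0[OF this gens_ok_tword[OF assms(1-3)], of b] show ?thesis
      using assms(4) by simp
  qed
  finally show ?thesis .
qed

text \<open>A vertex is absorbed or kills the word. A ghost edge extends \<open>q\<close> or kills
  the word. A real edge meets the last ghost edge of \<open>q\<close> and either cancels it or gives
  0 by (CK1). Only when \<open>q\<close> is empty can it extend \<open>p\<close>, and then the
  common range moves to \<open>r f\<close>, which must lie in \<open>W\<close>.\<close>

lemma tword_append_gen:
  assumes t: "(p, v, q) \<in> triples F W n" and FE: "F \<subseteq> E" and WV: "W \<subseteq> V" and W: "s ` F \<union> r ` F \<subseteq> W"
    and g: "g \<in> GV ` W \<union> GE ` F \<union> GG ` F"
  shows "mon (tword p v q @ [g]) \<approx> 0 \<or>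
    (\<exists>(p', v', q') \<in> triples F W (Suc n). mon (tword p v q @ [g]) \<approx> mon (tword p' v' q'))"
proof -
  have pq: "v \<in> W" "set p \<subseteq> F" "set q \<subseteq> F" "rpath p v" "rpath q v" "length p \<le> n" "length q \<le> n" "v \<in> V"
    using t WV by (auto simp: triples_def)
  note path = pq(4,5,8)
  have "gens_ok (tword p v q)" using gens_ok_tword path by blast
  have mono: "(p, v, q) \<in> triples F W (Suc n)" using t by (auto simp: triples_def)
  consider w where "g = GV w" "w \<in> W" | e where "g = GG e" "e \<in> F" | f where "g = GE f" "f \<in> F"
    using g by blast
  then show ?thesis
  proof cases
    case (1 w)
    show ?thesis
    proof (cases "w = start q v")
      case True
      then have "mon (tword p v q @ [g]) \<approx> mon (tword p v q)"
        using tword_start[OF path] 1 by simp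
      then show ?thesis using mono by blast
    next
      case False
      then show ?thesis using tword_kill[OF path, of w "[]"] 1 WV by auto
    qed
  next
    case (2 e)
    then have e: "e \<in> E" "r e \<in> V" using FE range by auto
    from eqv_sym[OF mon_replace_word[OF rel_E2r[OF e(1)] \<open>gens_ok (tword p v q)\<close>, of "[]"]]
    have eq: "mon (tword p v q @ [g]) \<approx> mon (tword p v q @ GV (r e) # [GG e])"
      using 2 by simp
    show ?thesis
    proof (cases "r e = start q v")
      case True
      then have "(p, v, q @ [e]) \<in> triples F W (Suc n)"
        using pq 2 e by (auto simp: triples_def)
      moreover have "tword p v q @ [g] = tword p v (q @ [e])" using 2 by (simp add: tword_def)
      ultimately show ?thesis by (metis (mono_tags, lifting) case_prodI eqv_refl)
    next
      case False
      then show ?thesis using eqv_trans[OF eq tword_kill[OF path, of "r e" "[GG e]"]] e by simp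
    qed
  next
    case (3 f)
    then have f: "f \<in> E" "s f \<in> V" "r f \<in> W" "r f \<in> V" "s f \<in> W" using FE range source W by auto
    show ?thesis
    proof (cases q rule: rev_cases)
      case Nil
      show ?thesis
      proof (cases "s f = v")
        case True
        have "mon [GV (s f), GE f] \<approx> mon [GE f]" using rel_E1s f by blast
        also have "\<dots> \<approx> mon [GE f, GV (r f)]" using eqv_sym rel_E1r f by blast
        finally have *: "mon [GV (s f), GE f] \<approx> mon [GE f, GV (r f)]" .
        have "mon (tword p v q @ [g]) \<approx> mon (tword (f # p) (r f) [])"
          using mon_replace_word[OF *, of "map GE (rev p)" "[]"] 3 Nil True rpath_subset[OF pq(4)]
          by (simp add: tword_def)
        moreover have "(f # p, r f, []) \<in> triples F W (Suc n)"
          using pq 3 f True by (auto simp: triples_def)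
        ultimately show ?thesis by blast
      next
        case False
        from eqv_sym[OF mon_replace_word[OF rel_E1s[OF f(1)] \<open>gens_ok (tword p v q)\<close>, of "[]"]]
        have eq: "mon (tword p v q @ [g]) \<approx> mon (tword p v q @ GV (s f) # [GE f])"
          using 3 by simp
        then show ?thesis
          using eqv_trans[OF eq tword_kill[OF path, of "s f" "[GE f]"]] f False Nil by simp
      qed
    next
      case (snoc q' e)
      then have e: "e \<in> E" "rpath q' v" "r e = start q' v" using pq by auto
      have ok: "gens_ok (tword p v q')" using gens_ok_tword path e by blast
      have split: "tword p v q @ [g] = tword p v q' @ [GG e, GE f] @ []"
        using snoc 3 by (simp add: tword_def)
      show ?thesis
      proof (cases "e = f")
        case True
        have "mon [GG e, GE f] \<approx> mon [GV (start q' v)]"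
          using rel_CK1[OF e(1) f(1)] True e by simp
        from mon_replace_word[OF this ok, of "[]"]
        have "mon (tword p v q @ [g]) \<approx> mon (tword p v q' @ [GV (start q' v)])"
          unfolding split by simp
        also have "\<dots> \<approx> mon (tword p v q')" using tword_start path e by blast
        finally have "mon (tword p v q @ [g]) \<approx> mon (tword p v q')" .
        moreover have "(p, v, q') \<in> triples F W (Suc n)"
          using pq snoc by (auto simp: triples_def)
        ultimately show ?thesis by blast
      next
        case False
        then have "mon [GG e, GE f] \<approx> 0" using rel_CK1[OF e(1) f(1)] by simp
        from mon_replace_0[OF this ok, of "[]"] show ?thesis unfolding split by simp
      qed
    qed
  qed
qed

lemma word_to_triple:
  assumes FE: "F \<subseteq> E" and WV: "W \<subseteq> V" and W: "s ` F \<union> r ` F \<subseteq> W"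
    and "set w \<subseteq> GV ` W \<union> GE ` F \<union> GG ` F" "w \<noteq> []"
  shows "mon w \<approx> 0 \<or> (\<exists>(p, v, q) \<in> triples F W (length w). mon w \<approx> mon (tword p v q))"
  using assms(4,5)
proof (induction w rule: rev_induct)
  case (snoc g w)
  have g: "g \<in> GV ` W \<union> GE ` F \<union> GG ` F" using snoc.prems by simp
  have okg: "gens_ok [g]" using g FE WV by auto
  show ?case
  proof (cases "w = []")
    case True
    \<comment> \<open>Every generator absorbs some vertex on its left, so the first letter can be
      treated as appended to a trivial triple of length 0.\<close>
    have "\<exists>v\<in>W. mon [g] \<approx> mon [GV v, g]"
    proof -
      consider v where "g = GV v" "v \<in> W" | e where "g = GG e" "e \<in> F" | e where "g = GE e" "e \<in> F"
        using g by blast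
      then show ?thesis
      proof cases
        case 1
        then show ?thesis using eqv_sym[OF rel_V[of v v]] WV by auto
      next
        case 2
        then show ?thesis using eqv_sym[OF rel_E2r[of e]] FE W by (intro bexI[of _ "r e"]) auto
      next
        case 3
        then show ?thesis using eqv_sym[OF rel_E1s[of e]] FE W by (intro bexI[of _ "s e"]) auto
      qed
    qed
    then obtain v where v: "v \<in> W" "mon [g] \<approx> mon (tword [] v [] @ [g])"
      by (auto simp: tword_def)
    have "([], v, []) \<in> triples F W 0" using v by (simp add: triples_def)
    from tword_append_gen[OF this FE WV W g] show ?thesis
      using eqv_trans[OF v(2)] True by fastforce
  next
    case False
    with snoc consider "mon w \<approx> 0"
      | p v q where "(p, v, q) \<in> triples F W (length w)" "mon w \<approx> mon (tword p v q)"
      by auto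
    then show ?thesis
    proof cases
      case 1
      from eqv_right[OF this mon_alg1[OF okg]] show ?thesis by simp
    next
      case 2
      from eqv_right[OF 2(2) mon_alg1[OF okg]]
      have "mon (w @ [g]) \<approx> mon (tword p v q @ [g])" by simp
      from eqv_trans[OF this] tword_append_gen[OF 2(1) FE WV W g] show ?thesis
        unfolding length_append_singleton by blast
    qed
  qed
qed simp

end

locale no_exit_lpa = lpa V E s r K + no_exit_graph V E s r
  for V :: "'v set" and E :: "'e set" and s r :: "'e \<Rightarrow> 'v" and K :: "'k::field itself"
begin

text \<open>\<open>s e\<close> emits \<open>e\<close> alone, so it is regular and (CK2) has one
  summand.\<close>

lemma cyclic_CK2:
  assumes "cyclic e"
  shows "mon [GE e, GG e] \<approx> mon [GV (s e)]"
proof -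
  have e: "e \<in> E" using assms by (simp add: cyclic_def)
  have "{f \<in> E. s f = s e} = {e}" using cyclic_unique[OF assms] e by blast
  then show ?thesis
    using eqv_sym[OF rel_CK2[of "s e"]] source[OF e] by (simp add: regular_def)
qed

text \<open>By \<open>cyclic_CK2\<close> a shared cyclic last edge \<open>e\<close> cancels. Both
  paths become shorter and their common range moves back to \<open>s e\<close>, which must lie in
  \<open>W\<close>.\<close>

lemma triple_to_normal:
  assumes WV: "W \<subseteq> V" and W: "s ` F \<subseteq> W" and "(p, v, q) \<in> triples F W n"
  shows "\<exists>(p', v', q') \<in> normal F W n. mon (tword p v q) \<approx> mon (tword p' v' q')"
  using assms(3)
proof (induction p arbitrary: v q)
  case Nil
  then have "([], v, q) \<in> normal F W n" by (simp add: normal_def)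
  then show ?case using eqv_refl by blast
next
  case (Cons e p)
  show ?case
  proof (cases "\<exists>q'. q = e # q' \<and> cyclic e")
    case False
    then have "(e # p, v, q) \<in> normal F W n" using Cons.prems by (auto simp: normal_def)
    then show ?thesis using eqv_refl by blast
  next
    case True
    then obtain q' where q: "q = e # q'" "cyclic e" by blast
    have t: "(p, s e, q') \<in> triples F W n" and e: "e \<in> E" "v = r e"
      using Cons.prems W q by (auto simp: triples_def)
    have "rpath p (s e)" "rpath q' (s e)" using t by (auto simp: triples_def)
    then have ok: "gens_ok (map GE (rev p))" "gens_ok (map GG q')"
      using rpath_subset by auto
    have okG: "gens_ok [GG e]" using e by simp
    have "mon [GE e, GV (r e), GG e] \<approx> mon [GE e, GG e]"
      using mon_replace_word[OF rel_E1r[OF e(1)], of "[]", OF _ okG] by simp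
    also have "\<dots> \<approx> mon [GV (s e)]" using cyclic_CK2 q by blast
    finally have "mon [GE e, GV (r e), GG e] \<approx> mon [GV (s e)]" .
    from mon_replace_word[OF this ok]
    have "mon (tword (e # p) v q) \<approx> mon (tword p (s e) q')"
      by (simp add: tword_def q e)
    then show ?thesis using Cons.IH[OF t] eqv_trans by blast
  qed
qed

end

section \<open>Growth\<close>

context lpa
begin

text \<open>This is the multiplication rule of the matrix units \<open>y ^ i * w * x ^ j\<close>.
  Equal powers cancel against \<open>w\<close>; a surplus \<open>x\<close> then meets
  \<open>w\<close> from the left or a surplus \<open>y\<close> from the right, and both
  \<open>x * w\<close> and \<open>w * y\<close> vanish.\<close>

lemma matrix_units:
  assumes A: "x \<in> alg" "y \<in> alg" "u \<in> alg"
    and uu: "u * u \<approx> u" and xu: "x * u \<approx> x" and ux: "u * x \<approx> x"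
    and yu: "y * u \<approx> y" and uy: "u * y \<approx> y" and xy: "x * y \<approx> u"
  defines "w \<equiv> u - y * x"
  shows "w * x ^ k * y ^ i * w \<approx> (if i = k then w else 0)"
proof -
  have wA: "w \<in> alg" using A by (simp add: w_def alg_mult alg_diff)
  have A1: "x \<in> insert 1 alg" "y \<in> insert 1 alg" "u \<in> insert 1 alg" "w \<in> insert 1 alg"
    "\<And>n. x ^ n \<in> insert 1 alg" "\<And>n. y ^ n \<in> insert 1 alg"
    using A wA alg1_power by auto
  note mult = alg1_mult
  have xw: "x * w \<approx> 0"
  proof -
    have "(x * y) * x \<approx> u * x" using xy A1(1) by (rule eqv_right)
    then have "x * y * x \<approx> x" using ux eqv_trans by blast
    from eqv_diff[OF xu this] show ?thesis by (simp add: w_def algebra_simps)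
  qed
  have wy: "w * y \<approx> 0"
  proof -
    have "y * (x * y) \<approx> y * u" using xy A1(2) by (rule eqv_left)
    then have "y * (x * y) \<approx> y" using yu eqv_trans by blast
    from eqv_diff[OF uy this] show ?thesis by (simp add: w_def algebra_simps)
  qed
  have uw: "u * w \<approx> w"
  proof -
    have "u * y * x \<approx> y * x" using uy A1(1) by (rule eqv_right)
    from eqv_diff[OF uu this] show ?thesis by (simp add: w_def algebra_simps)
  qed
  have wu: "w * u \<approx> w"
  proof -
    have "y * (x * u) \<approx> y * x" using xu A1(2) by (rule eqv_left)
    from eqv_diff[OF uu this] show ?thesis by (simp add: w_def algebra_simps)
  qed
  have ww: "w * w \<approx> w"
  proof -
    have "y * (x * w) \<approx> y * 0" using xw A1(2) by (rule eqv_left)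
    from eqv_diff[OF uw this] show ?thesis by (simp add: w_def algebra_simps)
  qed
  have wxu: "w * x ^ n * u \<approx> w * x ^ n" for n
  proof (cases n)
    case (Suc m)
    have "(w * x ^ m) * (x * u) \<approx> (w * x ^ m) * x" using xu mult[OF A1(4,5)] by (rule eqv_left)
    then show ?thesis using Suc by (simp add: power_Suc2 mult.assoc del: power_Suc)
  qed (use wu in simp)
  have wxy: "w * x ^ n * y ^ n \<approx> w" for n
  proof (induction n)
    case (Suc n)
    have "(w * x ^ n) * (x * y) \<approx> (w * x ^ n) * u" using xy mult[OF A1(4,5)] by (rule eqv_left)
    then have "(w * x ^ n) * (x * y) \<approx> w * x ^ n" using wxu eqv_trans by blast
    from eqv_right[OF this A1(6)[of n]] Suc.IH have "(w * x ^ n) * (x * y) * y ^ n \<approx> w"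
      using eqv_trans by blast
    moreover have "w * x ^ Suc n * y ^ Suc n = (w * x ^ n) * (x * y) * y ^ n"
      by (simp only: power_Suc2[of x n] power_Suc[of y n] mult.assoc)
    ultimately show ?case by simp
  qed simp
  have uyw: "u * y ^ n * w \<approx> y ^ n * w" for n
  proof (cases n)
    case (Suc m)
    have "(u * y) * (y ^ m * w) \<approx> y * (y ^ m * w)" using uy mult[OF A1(6,4)] by (rule eqv_right)
    then show ?thesis using Suc by (simp add: mult.assoc)
  qed (use uw in simp)
  have xyw: "x ^ n * y ^ n * w \<approx> w" for n
  proof (induction n)
    case (Suc n)
    have "(x * y) * (y ^ n * w) \<approx> u * (y ^ n * w)" using xy mult[OF A1(6,4)] by (rule eqv_right)
    then have "(x * y) * (y ^ n * w) \<approx> y ^ n * w" using eqv_trans[OF _ uyw[of n]] by (simp add: mult.assoc)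
    from eqv_left[OF this A1(5)[of n]] have "x ^ n * ((x * y) * (y ^ n * w)) \<approx> x ^ n * y ^ n * w"
      by (simp only: mult.assoc)
    from eqv_trans[OF this Suc.IH] have "x ^ n * ((x * y) * (y ^ n * w)) \<approx> w" .
    moreover have "x ^ Suc n * y ^ Suc n * w = x ^ n * ((x * y) * (y ^ n * w))"
      by (simp only: power_Suc2[of x n] power_Suc[of y n] mult.assoc)
    ultimately show ?case by simp
  qed simp
  consider "i = k" | m where "k = Suc m + i" | m where "i = k + Suc m"
    by (metis add.commute add_Suc_right less_imp_Suc_add linorder_neqE_nat)
  then show ?thesis
  proof cases
    case 1
    have "w * x ^ k * y ^ k * w \<approx> w * w" using eqv_right[OF wxy A1(4)] .
    then show ?thesis using ww eqv_trans 1 by auto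
  next
    case 2
    have "(w * x ^ Suc m) * (x ^ i * y ^ i * w) \<approx> (w * x ^ Suc m) * w"
      using xyw mult[OF A1(4,5)] by (rule eqv_left)
    moreover have "(w * x ^ m) * (x * w) \<approx> (w * x ^ m) * 0"
      using xw mult[OF A1(4,5)] by (rule eqv_left)
    moreover have "(w * x ^ Suc m) * (x ^ i * y ^ i * w) = w * x ^ k * y ^ i * w"
      by (simp only: 2 power_add mult.assoc)
    moreover have "(w * x ^ Suc m) * w = (w * x ^ m) * (x * w)"
      by (simp only: power_Suc2 mult.assoc)
    ultimately show ?thesis using 2 eqv_trans by auto
  next
    case 3
    have "(w * x ^ k * y ^ k) * (y ^ Suc m * w) \<approx> w * (y ^ Suc m * w)"
      using wxy mult[OF A1(6,4)] by (rule eqv_right)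
    moreover have "(w * y) * (y ^ m * w) \<approx> 0 * (y ^ m * w)"
      using wy mult[OF A1(6,4)] by (rule eqv_right)
    moreover have "(w * x ^ k * y ^ k) * (y ^ Suc m * w) = w * x ^ k * y ^ i * w"
      by (simp only: 3 power_add mult.assoc)
    moreover have "w * (y ^ Suc m * w) = (w * y) * (y ^ m * w)"
      by (simp only: power_Suc mult.assoc)
    ultimately show ?thesis using 3 eqv_trans by auto
  qed
qed

text \<open>Multiplying the relation by \<open>w * x ^ k\<close> on the left and
  \<open>y ^ l * w\<close> on the right leaves \<open>a (k, l)\<close> times \<open>w\<close>.
  Stated in this form, independence yields \<open>w \<approx> 0\<close> directly.\<close>

lemma matrix_units_independent:
  fixes a :: "nat \<times> nat \<Rightarrow> 'k"
  assumes A: "x \<in> alg" "y \<in> alg" "u \<in> alg"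
    and rels: "u * u \<approx> u" "x * u \<approx> x" "u * x \<approx> x" "y * u \<approx> y" "u * y \<approx> y" "x * y \<approx> u"
  defines "w \<equiv> u - y * x"
  assumes T: "finite T" and kl: "(k, l) \<in> T" "a (k, l) \<noteq> 0"
    and zero: "(\<Sum>(i, j)\<in>T. scale (a (i, j)) (y ^ i * w * x ^ j)) \<approx> 0"
  shows "w \<approx> 0"
proof -
  have wA: "w \<in> alg" using A by (simp add: w_def alg_mult alg_diff)
  note units = matrix_units[OF A rels, folded w_def]
  have wx: "w * x ^ j \<in> insert 1 alg" and yw: "y ^ j * w \<in> insert 1 alg" for j
    using wA alg1_power[OF A(1)] alg1_power[OF A(2)] by (intro alg1_mult; simp)+
  have summand: "w * x ^ k * (scale (a (i, j)) (y ^ i * w * x ^ j)) * (y ^ l * w)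
      \<approx> (if (i, j) = (k, l) then scale (a (k, l)) w else 0)" for i j
  proof -
    have "(w * x ^ k * y ^ i * w) * (x ^ j * (y ^ l * w))
        \<approx> (if i = k then w else 0) * (x ^ j * (y ^ l * w))"
      using units by (rule eqv_right) (use alg1_power[OF A(1)] yw alg1_mult in blast)
    also have "\<dots> \<approx> (if (i, j) = (k, l) then w else 0)"
      using units[of j l] by (auto simp: mult.assoc)
    finally have "scale (a (i, j)) ((w * x ^ k * y ^ i * w) * (x ^ j * (y ^ l * w)))
        \<approx> scale (a (i, j)) (if (i, j) = (k, l) then w else 0)" by (rule eqv_scale)
    moreover have "scale (a (i, j)) (if (i, j) = (k, l) then w else 0)
        = (if (i, j) = (k, l) then scale (a (k, l)) w else 0)" by (auto simp: scale_simps)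
    ultimately show ?thesis by (simp only: mult.assoc scale_mult)
  qed
  let ?z = "\<lambda>t. case t of (i, j) \<Rightarrow> scale (a (i, j)) (y ^ i * w * x ^ j)"
  have "w * x ^ k * sum ?z T * (y ^ l * w) \<approx> w * x ^ k * 0 * (y ^ l * w)"
    by (intro eqv_right eqv_left zero wx yw)
  then have 1: "w * x ^ k * sum ?z T * (y ^ l * w) \<approx> 0" by simp
  have 2: "w * x ^ k * sum ?z T * (y ^ l * w) = (\<Sum>t\<in>T. w * x ^ k * ?z t * (y ^ l * w))"
    by (simp only: sum_distrib_left sum_distrib_right)
  have 3: "(\<Sum>t\<in>T. w * x ^ k * ?z t * (y ^ l * w)) \<approx> (\<Sum>t\<in>T. if t = (k, l) then scale (a (k, l)) w else 0)"
  proof (rule eqv_sum)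
    fix t assume "t \<in> T"
    obtain i j where t: "t = (i, j)" by fastforce
    show "w * x ^ k * ?z t * (y ^ l * w) \<approx> (if t = (k, l) then scale (a (k, l)) w else 0)"
      unfolding t prod.case by (rule summand)
  qed
  have 4: "(\<Sum>t\<in>T. if t = (k, l) then scale (a (k, l)) w else 0) = scale (a (k, l)) w"
    using T kl(1) by simp
  have "scale (a (k, l)) w \<approx> 0"
    using eqv_trans[OF eqv_sym[OF 3] 1[unfolded 2]] unfolding 4 .
  from eqv_scale[OF this, of "inverse (a (k, l))"] show ?thesis
    using kl(2) by (simp add: scale_simps)
qed

end

section \<open>Filtration by word length, and the dimension count\<close>

definition degree_le :: "('v, 'e) gen set \<Rightarrow> nat \<Rightarrow> ('v, 'e, 'k::field) ser set" where
  "degree_le G n = {x. \<forall>w\<in>supp x. set w \<subseteq> G \<and> length w \<le> n}"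

lemma degree_le_mult:
  "x \<in> degree_le G m \<Longrightarrow> y \<in> degree_le G n \<Longrightarrow> x * y \<in> degree_le G (m + n)"
  using supp_mult[of x y] by (fastforce simp: degree_le_def)

lemma degree_le_1: "1 \<in> degree_le G 0"
  by (simp add: degree_le_def mon_Nil[symmetric] supp_simps)

lemma degree_le_power: "x \<in> degree_le G m \<Longrightarrow> x ^ n \<in> degree_le G (n * m)"
  by (induction n) (auto simp: degree_le_1 intro: degree_le_mult)

lemma degree_le_diff: "x \<in> degree_le G m \<Longrightarrow> y \<in> degree_le G m \<Longrightarrow> x - y \<in> degree_le G m"
  using supp_simps(2)[of x y] by (fastforce simp: degree_le_def)

lemma degree_le_mono: "x \<in> degree_le G m \<Longrightarrow> m \<le> n \<Longrightarrow> x \<in> degree_le G n"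
  by (fastforce simp: degree_le_def)

context no_exit_lpa
begin

lemma degree_le_span:
  assumes FE: "F \<subseteq> E" and WV: "W \<subseteq> V" and W: "s ` F \<union> r ` F \<subseteq> W" and fin: "finite (normal F W n)"
    and x: "x \<in> alg" "x \<in> degree_le (GV ` W \<union> GE ` F \<union> GG ` F) n"
  shows "\<exists>M. x \<approx> (\<Sum>t\<in>normal F W n. scale (M t) (case t of (p, v, q) \<Rightarrow> mon (tword p v q)))"
proof -
  let ?N = "normal F W n" and ?m = "\<lambda>(p, v, q). mon (tword p v q) :: ('v, 'e, 'k) ser"
  have "\<exists>M. mon w \<approx> (\<Sum>t\<in>?N. scale (M t) (?m t))" if "w \<in> supp x" for w
  proof -
    have w: "set w \<subseteq> GV ` W \<union> GE ` F \<union> GG ` F" "w \<noteq> []" "length w \<le> n"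
      using that x by (auto simp: alg_iff degree_le_def word_ok_def)
    from word_to_triple[OF FE WV W w(1,2)] consider "mon w \<approx> 0"
      | p v q where "(p, v, q) \<in> triples F W n" "mon w \<approx> mon (tword p v q)"
      using w(3) by (fastforce simp: triples_def)
    then show ?thesis
    proof cases
      case 1
      then show ?thesis by (intro exI[of _ "\<lambda>_. 0"]) (simp add: scale_simps)
    next
      case 2
      have "s ` F \<subseteq> W" using W by simp
      from triple_to_normal[OF WV this 2(1)] obtain t where t: "t \<in> ?N" "mon w \<approx> ?m t"
        using eqv_trans[OF 2(2)] by auto
      have "(\<Sum>t'\<in>?N. scale (if t' = t then 1 else 0) (?m t')) = (\<Sum>t'\<in>?N. if t' = t then ?m t' else 0)"
        by (rule sum.cong) (auto simp: scale_simps)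
      also have "\<dots> = ?m t" using t(1) fin by simp
      finally show ?thesis using t(2) by (intro exI[of _ "\<lambda>t'. if t' = t then 1 else 0"]) (simp only:)
    qed
  qed
  then have "\<forall>w\<in>supp x. \<exists>M. mon w \<approx> (\<Sum>t\<in>?N. scale (M t) (?m t))" by blast
  from bchoice[OF this] obtain M where
    M: "\<And>w. w \<in> supp x \<Longrightarrow> mon w \<approx> (\<Sum>t\<in>?N. scale (M w t) (?m t))" by blast
  have "x = (\<Sum>w\<in>supp x. scale (coeff x w) (mon w))"
    using x(1) by (intro mon_expansion) (auto simp: alg_iff)
  also have "\<dots> \<approx> (\<Sum>w\<in>supp x. scale (coeff x w) (\<Sum>t\<in>?N. scale (M w t) (?m t)))"
    using M by (intro eqv_sum eqv_scale)
  also have "(\<Sum>w\<in>supp x. scale (coeff x w) (\<Sum>t\<in>?N. scale (M w t) (?m t)))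
      = (\<Sum>t\<in>?N. scale (\<Sum>w\<in>supp x. coeff x w * M w t) (?m t))"
    unfolding scale_sum sum_scale by (subst sum.swap) (simp add: scale_simps)
  finally show ?thesis by (intro exI[of _ "\<lambda>t. \<Sum>w\<in>supp x. coeff x w * M w t"])
qed

lemma directly_finite:
  assumes A: "x \<in> alg" "y \<in> alg" "u \<in> alg"
    and rels: "u * u \<approx> u" "x * u \<approx> x" "u * x \<approx> x" "y * u \<approx> y" "u * y \<approx> y" "x * y \<approx> u"
  shows "y * x \<approx> u"
proof -
  define w where "w = u - y * x"
  define S where "S = supp x \<union> supp y \<union> supp u"
  have S: "finite S" "\<And>z. z \<in> S \<Longrightarrow> word_ok V E z" using A by (auto simp: S_def alg_iff)
  define gens where "gens = \<Union> (set ` S)"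
  have gens: "finite gens" "\<And>g. g \<in> gens \<Longrightarrow> gen_ok V E g"
    using S by (auto simp: gens_def word_ok_def)
  define F where "F = {e. GE e \<in> gens} \<union> {e. GG e \<in> gens}"
  define W where "W = {v. GV v \<in> gens} \<union> s ` F \<union> r ` F"
  define G where "G = GV ` W \<union> GE ` F \<union> GG ` F"
  have "finite {e. GE e \<in> gens}" "finite {e. GG e \<in> gens}" "finite {v. GV v \<in> gens}"
    using gens(1) finite_vimageI[of gens GE] finite_vimageI[of gens GG] finite_vimageI[of gens GV]
    by (auto simp: vimage_def inj_def)
  then have fin: "finite F" "finite W" by (auto simp: F_def W_def)
  have FE: "F \<subseteq> E" using gens(2) by (auto simp: F_def gen_ok_def dest: gens(2))
  have WV: "W \<subseteq> V" using gens(2) FE source range by (fastforce simp: W_def gen_ok_def)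
  have W: "s ` F \<union> r ` F \<subseteq> W" by (auto simp: W_def)
  have gG: "gens \<subseteq> G"
  proof
    fix g assume "g \<in> gens"
    then show "g \<in> G" by (cases g) (auto simp: G_def W_def F_def)
  qed
  \<comment> \<open>The 0 keeps \<open>Max\<close> away from the empty set in case \<open>x\<close>,
    \<open>y\<close> and \<open>u\<close> are all 0.\<close>
  define L where "L = Max (length ` S \<union> {0})"
  have "length z \<le> L" "set z \<subseteq> G" if "z \<in> S" for z
    using that S(1) gG by (auto simp: L_def gens_def)
  then have deg: "x \<in> degree_le G L" "y \<in> degree_le G L" "u \<in> degree_le G L"
    by (auto simp: degree_le_def S_def)
  have wA: "w \<in> alg" using A by (simp add: w_def alg_mult alg_diff)
  have w: "w \<in> degree_le G (L + L)"
    unfolding w_def using degree_le_mult[OF deg(2,1)] degree_le_mono[OF deg(3)] by (intro degree_le_diff) auto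
  obtain C where C: "\<And>n. finite (normal F W n)" "\<And>n. card (normal F W n) \<le> C * Suc n"
    using card_normal[OF fin] by blast
  \<comment> \<open>\<open>n\<close> bounds the word lengths in \<open>y ^ i * w * x ^ j\<close>: at
    most \<open>L\<close> for each factor \<open>x\<close> or \<open>y\<close>, and
    \<open>2 * L\<close> for \<open>w\<close>. Since \<open>Suc n\<close> is at most
    \<open>N * Suc (4 * L)\<close>, there are at most
    \<open>C * N * Suc (4 * L) = (N - 1) * N\<close> normal triples, fewer than
    \<open>N * N\<close>.\<close>
  define N where "N = C * Suc (4 * L) + 1"
  define n where "n = N * L + (L + L) + N * L"
  define T where "T = {..<N} \<times> {..<N}"
  let ?z = "\<lambda>(i, j). y ^ i * w * x ^ j" and ?B = "normal F W n"
  have z: "?z t \<in> alg" "?z t \<in> degree_le G n" if "t \<in> T" for t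
  proof -
    obtain i j where "t = (i, j)" by fastforce
    then have t: "t = (i, j)" "i \<le> N" "j \<le> N" using that by (auto simp: T_def)
    show "?z t \<in> alg"
      using alg_mult_alg1[OF alg1_mult_alg[OF alg1_power[OF A(2)] wA] alg1_power[OF A(1)]] t by simp
    have "y ^ i * w * x ^ j \<in> degree_le G (i * L + (L + L) + j * L)"
      by (intro degree_le_mult degree_le_power deg w)
    moreover have "i * L + (L + L) + j * L \<le> n"
      unfolding n_def using t by (intro add_mono mult_le_mono) auto
    ultimately show "?z t \<in> degree_le G n" using t degree_le_mono by simp
  qed
  have "\<forall>t\<in>T. \<exists>M. ?z t \<approx> (\<Sum>b\<in>?B. scale (M b) (case b of (p, v, q) \<Rightarrow> mon (tword p v q)))"
    using degree_le_span[OF FE WV W C(1) z(1)] z(2) unfolding G_def by blast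
  from bchoice[OF this] obtain M where M: "\<And>t. t \<in> T \<Longrightarrow>
      ?z t \<approx> (\<Sum>b\<in>?B. scale (M t b) (case b of (p, v, q) \<Rightarrow> mon (tword p v q)))" by blast
  have "Suc n \<le> N * Suc (4 * L)"
  proof -
    have N: "1 \<le> N" by (simp add: N_def)
    then have "L \<le> N * L" using mult_le_mono1[of 1 N L] by simp
    moreover have "N * Suc (4 * L) = N + 4 * (N * L)" by (simp add: algebra_simps)
    ultimately show ?thesis using N unfolding n_def by linarith
  qed
  then have "C * Suc n \<le> C * (N * Suc (4 * L))" by (rule mult_le_mono2)
  also have "\<dots> < N * N" by (simp add: N_def algebra_simps)
  finally have "card ?B < card T" using C(2)[of n] by (simp add: T_def)
  \<comment> \<open>There are more products \<open>y ^ i * w * x ^ j\<close> than normal words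
    spanning them, which gives a nontrivial relation among the products.\<close>
  from homogeneous_system_nontrivial[OF C(1) _ this, of M] obtain a where
    a: "\<exists>t\<in>T. a t \<noteq> 0" "\<And>b. b \<in> ?B \<Longrightarrow> (\<Sum>t\<in>T. a t * M t b) = 0"
    by (auto simp: T_def)
  let ?m = "\<lambda>(p, v, q). mon (tword p v q) :: ('v, 'e, 'k) ser"
  have "(\<Sum>t\<in>T. scale (a t) (?z t)) \<approx> (\<Sum>t\<in>T. scale (a t) (\<Sum>b\<in>?B. scale (M t b) (?m b)))"
    using M by (intro eqv_sum eqv_scale)
  also have "\<dots> = (\<Sum>b\<in>?B. scale (\<Sum>t\<in>T. a t * M t b) (?m b))"
    unfolding scale_sum sum_scale by (subst sum.swap) (simp add: scale_simps)
  also have "\<dots> = 0" using a(2) by (simp add: scale_simps)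
  finally have zero: "(\<Sum>(i, j)\<in>T. scale (a (i, j)) (y ^ i * w * x ^ j)) \<approx> 0"
    by (simp add: case_prod_unfold)
  obtain k l where "(k, l) \<in> T" "a (k, l) \<noteq> 0" using a(1) by auto
  from matrix_units_independent[OF A rels, of T k l a, OF _ this] zero have "w \<approx> 0"
    by (simp add: w_def T_def)
  then show ?thesis using eqv_sym[of u "y * x"] by (simp add: eqv_def w_def)
qed

end

section \<open>Boundary paths\<close>

context lpa
begin

text \<open>A point is an infinite path, or a finite path ending in a vertex that is not regular, padded
  by repeating that vertex. Prepending and removing edges gives a representation of the algebra in
  which no vertex acts as zero.\<close>

definition initial :: "(nat \<Rightarrow> 'v + 'e) \<Rightarrow> 'v" where
  "initial x = case_sum id s (x 0)"

definition boundary :: "(nat \<Rightarrow> 'v + 'e) \<Rightarrow> bool" where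
  "boundary x \<longleftrightarrow> (\<forall>i. case x i of
      Inl v \<Rightarrow> \<not> regular E s v \<and> x (Suc i) = Inl v
    | Inr e \<Rightarrow> e \<in> E \<and> case_sum id s (x (Suc i)) = r e)"

text \<open>The action on the basis of a representation: a generator sends a point to a point or to
  zero, written \<open>None\<close>.\<close>

primrec act_gen :: "('v, 'e) gen \<Rightarrow> (nat \<Rightarrow> 'v + 'e) \<Rightarrow> (nat \<Rightarrow> 'v + 'e) option" where
  "act_gen (GV v) x = (if initial x = v then Some x else None)"
| "act_gen (GE e) x = (if e \<in> E \<and> initial x = r e then Some (case_nat (Inr e) x) else None)"
| "act_gen (GG e) x = (if x 0 = Inr e then Some (\<lambda>i. x (Suc i)) else None)"

primrec act :: "('v, 'e) gen list \<Rightarrow> (nat \<Rightarrow> 'v + 'e) \<Rightarrow> (nat \<Rightarrow> 'v + 'e) option" where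
  "act [] x = Some x"
| "act (g # w) x = Option.bind (act w x) (act_gen g)"

lemma act_append: "act (v @ w) x = Option.bind (act w x) (act v)"
  by (induction v) (auto split: bind_split)

lemma boundary_act_gen:
  assumes "boundary x" "act_gen g x = Some y"
  shows "boundary y"
proof (cases g)
  case (GE e)
  show ?thesis
    unfolding boundary_def
  proof
    fix i
    show "case y i of Inl v \<Rightarrow> \<not> regular E s v \<and> y (Suc i) = Inl v
      | Inr e \<Rightarrow> e \<in> E \<and> case_sum id s (y (Suc i)) = r e"
    proof (cases i)
      case 0
      then have "y i = Inr e" "y (Suc i) = x 0" "e \<in> E" "initial x = r e"
        using assms(2) GE by (auto split: if_splits)
      then show ?thesis by (simp add: initial_def)
    next
      case (Suc j)
      then have "y i = x j" "y (Suc i) = x (Suc j)"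
        using assms(2) GE by (auto split: if_splits)
      then show ?thesis using assms(1) by (simp only: boundary_def)
    qed
  qed
qed (use assms in \<open>auto simp: boundary_def split: if_splits\<close>)

lemma boundary_act: "boundary x \<Longrightarrow> act w x = Some y \<Longrightarrow> boundary y"
  by (induction w arbitrary: y) (auto simp: bind_eq_Some_conv intro: boundary_act_gen)

text \<open>Follow a chosen edge at each regular vertex, and stop at the first vertex that is not
  regular.\<close>

lemma boundary_exists: "\<exists>x. boundary x \<and> initial x = v"
proof -
  define first where
    "first v = (if regular E s v then Inr (SOME e. e \<in> E \<and> s e = v) else Inl v)" for v
  define x where "x i = ((case_sum Inl (\<lambda>e. first (r e))) ^^ i) (first v)" for i
  have first: "case_sum id s (first w) = w" "first w = Inr e \<Longrightarrow> e \<in> E"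
    "first w = Inl w' \<Longrightarrow> \<not> regular E s w'" for w w' e
  proof -
    have "(SOME e. e \<in> E \<and> s e = w) \<in> E \<and> s (SOME e. e \<in> E \<and> s e = w) = w" if "regular E s w"
    proof -
      have "\<exists>e. e \<in> E \<and> s e = w" using that by (auto simp: regular_def)
      then show ?thesis by (rule someI_ex)
    qed
    then show "case_sum id s (first w) = w" "first w = Inr e \<Longrightarrow> e \<in> E"
      "first w = Inl w' \<Longrightarrow> \<not> regular E s w'"
      by (auto simp: first_def split: if_splits)
  qed
  have step: "x (Suc i) = case_sum Inl (\<lambda>e. first (r e)) (x i)" for i
    by (simp add: x_def)
  have range: "(\<exists>e. x i = Inr e \<and> e \<in> E) \<or> (\<exists>v. x i = Inl v \<and> \<not> regular E s v)" for i
  proof (induction i)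
    case 0
    show ?case using first by (cases "first v") (auto simp: x_def)
  next
    case (Suc i)
    then show ?case
    proof
      assume "\<exists>e. x i = Inr e \<and> e \<in> E"
      then obtain e where "x i = Inr e" by blast
      then show ?thesis using first[of "r e"] by (cases "first (r e)") (auto simp: step)
    qed (auto simp: step)
  qed
  have "boundary x"
    unfolding boundary_def
  proof
    fix i
    show "case x i of Inl v \<Rightarrow> \<not> regular E s v \<and> x (Suc i) = Inl v
      | Inr e \<Rightarrow> e \<in> E \<and> case_sum id s (x (Suc i)) = r e"
      using range[of i] first(1) by (auto simp: step)
  qed
  moreover have "initial x = v" using first(1) by (simp add: initial_def x_def)
  ultimately show ?thesis by blast
qed

text \<open>\<open>k\<close> is a functional on the representation, zero at \<open>None\<close>. It
  is arbitrary so that \<open>lin_ideal\<close> can absorb a word to the left of the relation into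
  \<open>k\<close>, and a word to its right into the point \<open>x\<close>.\<close>

lemma lin_relation:
  assumes "\<rho> \<in> lpa_rels V E s r" "boundary x" "k None = (0 :: 'k)"
  shows "finite (supp (Ser \<rho>)) \<and> lin (\<lambda>w. k (act w x)) (Ser \<rho>) = 0"
proof -
  have head: "e \<in> E \<and> case_sum id s (x (Suc 0)) = r e" if "x 0 = Inr e" for e
    using assms(2) that unfolding boundary_def by (auto dest: spec[of _ 0])
  from assms(1) show ?thesis
  proof (cases rule: lpa_rels_cases)
    case (CK2 v)
    have fin: "finite (supp (\<Sum>e | e \<in> E \<and> s e = v. mon [GE e, GG e] :: ('v, 'e, 'k) ser))"
      by (rule finite_supp_sum) (simp add: supp_simps)
    \<comment> \<open>A point starting at the regular vertex \<open>v\<close> begins with an edge,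
      and among the products e e^* only the one of that edge fixes it. All other points give 0 on
      both sides.\<close>
    have "(\<Sum>e | e \<in> E \<and> s e = v. k (act [GE e, GG e] x)) = k (act [GV v] x)"
    proof (cases "x 0")
      case (Inl w)
      then have "initial x = w" "\<not> regular E s w"
        using assms(2) unfolding boundary_def initial_def by (auto dest: spec[of _ 0])
      then show ?thesis using CK2(2) Inl assms(3) by auto
    next
      case (Inr e)
      from head[OF this] have e: "e \<in> E" "case_sum id s (x (Suc 0)) = r e" by simp_all
      have "case_nat (Inr e) (\<lambda>i. x (Suc i)) = x"
        using Inr by (auto simp: fun_eq_iff split: nat.split)
      then have *: "k (act [GE f, GG f] x) = (if f = e then k (Some x) else 0)" for f
        using Inr e assms(3) by (auto simp: initial_def)
      show ?thesis
      proof (cases "s e = v")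
        case True
        then show ?thesis
          using CK2(2) e Inr unfolding * by (simp add: regular_def initial_def)
      next
        case False
        then have "(\<Sum>e | e \<in> E \<and> s e = v. k (act [GE e, GG e] x)) = 0"
          unfolding * by (intro sum.neutral) auto
        then show ?thesis using False Inr assms(3) by (simp add: initial_def)
      qed
    qed
    then show ?thesis
      unfolding CK2(3) using fin by (simp add: lin_diff lin_sum finite_supp supp_simps del: act.simps)
  qed (use assms(3) head in \<open>auto simp: lin_diff finite_supp supp_simps initial_def\<close>)
qed

text \<open>The functional is a matrix coefficient: it reads off how often \<open>y\<close> occurs
  when \<open>z\<close> acts on \<open>x\<close>.\<close>

lemma lin_ideal:
  assumes "z \<in> ideal" "boundary x"
  shows "finite (supp z) \<and> lin (\<lambda>w. if act w x = Some y then 1 else 0 :: 'k) z = 0"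
  using assms(1)
proof (induction rule: ideal_induct)
  case (gen \<rho> a b)
  let ?h = "\<lambda>w. if act w x = Some y then 1 else 0 :: 'k"
  have fin: "finite (supp c)" if "c \<in> insert 1 alg" for c :: "('v, 'e, 'k) ser"
    using that by (auto simp: alg_iff mon_Nil[symmetric] supp_simps)
  have fin\<rho>: "finite (supp (Ser \<rho>))"
    using lin_relation[OF gen(1) assms(2), of "\<lambda>_. 0"] by simp
  have "lin (\<lambda>z. ?h (v @ z @ w)) (Ser \<rho>) = 0" for v w
  proof (cases "act w x")
    case None
    then show ?thesis by (simp add: act_append lin_def)
  next
    case (Some x')
    have "lin (\<lambda>z. (\<lambda>p. if Option.bind p (act v) = Some y then 1 else 0) (act z x')) (Ser \<rho>) = 0"
      using lin_relation[OF gen(1) boundary_act[OF assms(2) Some],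
          of "\<lambda>p. if Option.bind p (act v) = Some y then 1 else 0"] by simp
    then show ?thesis using Some by (simp add: act_append)
  qed
  then show ?case
    using lin_mult_eq_0[of a "Ser \<rho>" b ?h] fin[OF gen(2)] fin[OF gen(3)] fin\<rho>
    by (simp add: finite_supp)
qed (auto simp: lin_add finite_supp supp_simps)

lemma vertex_not_in_ideal: "mon [GV v] \<notin> ideal"
proof
  assume v: "mon [GV v] \<in> ideal"
  obtain x where "boundary x" "initial x = v" using boundary_exists by blast
  then show False using lin_ideal[OF v, of x x] by simp
qed

end

section \<open>The involution\<close>

definition star :: "('k \<Rightarrow> 'k) \<Rightarrow> ('v, 'e, 'k::field) ser \<Rightarrow> ('v, 'e, 'k) ser" where
  "star c x = Ser (fstar c (coeff x))"

definition rstar :: "('v, 'e) gen list \<Rightarrow> ('v, 'e) gen list" where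
  "rstar w = rev (map gstar w)"

lemma gstar_gstar [simp]: "gstar (gstar g) = g"
  by (cases g) auto

lemma rstar_rstar [simp]: "rstar (rstar w) = w"
  by (simp add: rstar_def rev_map comp_def)

lemma coeff_star [simp]: "coeff (star c x) w = c (coeff x (rstar w))"
  by (simp add: star_def fstar_def rstar_def)

locale involution =
  fixes c :: "'k::field \<Rightarrow> 'k"
  assumes involution: "field_involution c"
begin

lemma c_simps [simp]: "c (a + b) = c a + c b" "c (a * b) = c a * c b" "c (c a) = a"
  using involution by (simp_all add: field_involution_def)

lemma c_0 [simp]: "c 0 = 0"
proof -
  have "c 0 = c 0 + c 0" using c_simps(1)[of 0 0] by (simp only: add_0)
  then show ?thesis by (simp only: add_cancel_right_right)
qed

text \<open>\<open>c 1\<close> is idempotent, and nonzero because \<open>c\<close> is its own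
  inverse.\<close>

lemma c_1 [simp]: "c 1 = 1"
proof -
  have "c 1 \<noteq> 0"
  proof
    assume "c 1 = 0"
    then have "c (c 1) = 0" by (simp only: c_0)
    then show False by simp
  qed
  then show ?thesis using c_simps(2)[of 1 1] by (simp del: c_simps)
qed

lemma c_diff [simp]: "c (a - b) = c a - c b"
  using c_simps(1)[of "a - b" b] by (simp del: c_simps add: algebra_simps)

lemma c_sum: "c (sum f S) = (\<Sum>i\<in>S. c (f i))"
  by (induction S rule: infinite_finite_induct) simp_all

lemma star_simps:
  "star c 0 = 0" "star c (x + y) = star c x + star c y" "star c (x - y) = star c x - star c y"
  "star c (scale a x) = scale (c a) (star c x)" "star c (star c x) = x"
  by (rule ser_eqI; simp)+

lemma star_sum: "star c (sum f S) = (\<Sum>i\<in>S. star c (f i))"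
  by (rule ser_eqI) (simp add: c_sum)

lemma star_mon [simp]: "star c (mon w) = mon (rstar w)"
proof (rule ser_eqI)
  fix z
  have "rstar z = w \<longleftrightarrow> z = rstar w" by (metis rstar_rstar)
  then show "coeff (star c (mon w)) z = coeff (mon (rstar w)) z" by simp
qed

lemma star_1 [simp]: "star c 1 = 1"
  unfolding mon_Nil[symmetric] by (simp add: rstar_def)

text \<open>Reversal turns the cut of \<open>w\<close> at \<open>i\<close> into the cut of
  \<open>rstar w\<close> at \<open>?n - i\<close>; the factors swap by commutativity of the
  field.\<close>

lemma star_mult:
  fixes x y :: "('v, 'e, 'k) ser"
  shows "star c (x * y) = star c y * star c x"
proof (rule ser_eqI)
  fix w :: "('v, 'e) gen list"
  let ?n = "length w"
  have len: "length (rstar w) = ?n" by (simp add: rstar_def)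
  have *: "rstar (take i w) = drop (?n - i) (rstar w)" "rstar (drop i w) = take (?n - i) (rstar w)"
    if "i \<le> ?n" for i
    using that by (simp_all add: rstar_def take_map[symmetric] drop_map[symmetric] take_rev drop_rev)
  have "coeff (star c (x * y)) w = (\<Sum>i\<le>?n. c (coeff x (take i (rstar w))) * c (coeff y (drop i (rstar w))))"
    by (simp add: times_ser_def fmul_def c_sum len)
  also have "\<dots> = (\<Sum>i\<le>?n. c (coeff y (rstar (take i w))) * c (coeff x (rstar (drop i w))))"
    by (rule sum.reindex_bij_witness[where i = "\<lambda>i. ?n - i" and j = "\<lambda>i. ?n - i"])
      (auto simp: * mult.commute)
  also have "\<dots> = coeff (star c y * star c x) w"
    by (simp add: times_ser_def fmul_def)
  finally show "coeff (star c (x * y)) w = coeff (star c y * star c x) w" .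
qed

end

locale lpa_involution = lpa V E s r K + involution c
  for V :: "'v set" and E :: "'e set" and s r :: "'e \<Rightarrow> 'v" and K :: "'k::field itself"
    and c :: "'k \<Rightarrow> 'k"
begin

lemma star_alg: "x \<in> alg \<Longrightarrow> star c x \<in> alg"
proof -
  assume x: "x \<in> alg"
  have c_eq_0: "c a = 0 \<longleftrightarrow> a = 0" for a
  proof
    assume "c a = 0"
    then have "c (c a) = 0" by (simp only: c_0)
    then show "a = 0" by simp
  qed simp
  have supp: "supp (star c x) = rstar ` supp x"
  proof (intro set_eqI iffI)
    fix w assume "w \<in> supp (star c x)"
    then have "rstar w \<in> supp x" by (simp add: supp_def c_eq_0)
    then show "w \<in> rstar ` supp x" by (rule rev_image_eqI) simp
  qed (auto simp: supp_def c_eq_0)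
  have "gen_ok V E (gstar g) = gen_ok V E g" for g
    by (cases g) (auto simp: gen_ok_def)
  then have "word_ok V E (rstar w)" if "word_ok V E w" for w
    using that by (auto simp: word_ok_def rstar_def)
  then show ?thesis using x by (auto simp: alg_iff supp)
qed

text \<open>The star permutes the relations: it exchanges (E1) with (E2), swaps the two indices in
  (V) and (CK1), and fixes (CK2).\<close>

lemma star_relation:
  assumes "\<rho> \<in> lpa_rels V E s r"
  shows "star c (Ser \<rho>) \<in> ideal"
  using assms
proof (cases rule: lpa_rels_cases)
  case (V v w)
  then show ?thesis using rel_V[of w v]
    by (auto simp: star_simps rstar_def eqv_def split: if_splits)
next
  case (E1s e)
  then show ?thesis using rel_E2s[of e] by (simp add: star_simps rstar_def eqv_def)
next
  case (E1r e)
  then show ?thesis using rel_E2r[of e] by (simp add: star_simps rstar_def eqv_def)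
next
  case (E2r e)
  then show ?thesis using rel_E1r[of e] by (simp add: star_simps rstar_def eqv_def)
next
  case (E2s e)
  then show ?thesis using rel_E1s[of e] by (simp add: star_simps rstar_def eqv_def)
next
  case (CK1 e f)
  then show ?thesis using rel_CK1[of f e]
    by (auto simp: star_simps rstar_def eqv_def split: if_splits)
next
  case (CK2 v)
  then show ?thesis using rel_CK2[of v]
    by (simp add: star_simps star_sum rstar_def eqv_def)
qed

lemma star_ideal: "x \<in> ideal \<Longrightarrow> star c x \<in> ideal"
proof (induction rule: ideal_induct)
  case (gen \<rho> a b)
  then have "star c a \<in> insert 1 alg" "star c b \<in> insert 1 alg"
    using star_alg by auto
  then show ?case
    using ideal_mult_right[OF ideal_mult_left[OF star_relation[OF gen(1)]]]
    by (simp add: star_mult)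
qed (auto simp: star_simps ideal_add ideal_scale)

lemma star_eqv: "x \<approx> y \<Longrightarrow> star c x \<approx> star c y"
  using star_ideal[of "x - y"] by (simp add: eqv_def star_simps)

lemma directly_finite_imp_finite:
  assumes "lpa_directly_finite V E s r TYPE('k)"
  shows "lpa_finite c V E s r"
  unfolding lpa_finite_def
proof (intro ballI impI, elim conjE)
  fix x u :: "('v, 'e, 'k) fa"
  assume fa: "x \<in> fa_carrier V E" "u \<in> fa_carrier V E"
    and rels: "lpa_eq V E s r (fmul u u) u" "lpa_eq V E s r (fmul x u) x" "lpa_eq V E s r (fmul u x) x"
      "lpa_eq V E s r (fmul x (fstar c x)) u"
  let ?x = "Ser x" and ?u = "Ser u" and ?y = "star c (Ser x)"
  have A: "?x \<in> alg" "?u \<in> alg" "?y \<in> alg" using fa star_alg by (auto simp: alg_def)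
  have fa_y: "fstar c x \<in> fa_carrier V E"
    using A(3) unfolding alg_def star_def by (metis coeff_Ser imageE)
  have Ser: "Ser (fmul a b) = Ser a * Ser b" "Ser (fstar c a) = star c (Ser a)" for a b :: "('v, 'e, 'k) fa"
    by (simp_all add: times_ser_def star_def)
  have eqs: "?x * ?u \<approx> ?x" "?u * ?x \<approx> ?x" "?x * ?y \<approx> ?u"
    using rels by (simp_all add: lpa_eq_iff Ser)
  \<comment> \<open>As x x^* is self-adjoint, so is \<open>?u\<close> modulo the ideal. This turns
    the starred relations between \<open>?x\<close> and \<open>?u\<close> into those that direct
    finiteness demands of \<open>?y\<close>.\<close>
  have "?x * ?y \<approx> star c ?u" using star_eqv[OF eqs(3)] by (simp add: star_mult star_simps)
  then have u: "?u \<approx> star c ?u" using eqv_trans[OF eqv_sym[OF eqs(3)]] by blast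
  have "?y * ?u \<approx> ?y * star c ?u" using eqv_left[OF u] A by simp
  moreover have "?y * star c ?u \<approx> ?y" using star_eqv[OF eqs(2)] by (simp add: star_mult)
  ultimately have yu: "?y * ?u \<approx> ?y" by (rule eqv_trans)
  have "?u * ?y \<approx> star c ?u * ?y" using eqv_right[OF u] A by simp
  moreover have "star c ?u * ?y \<approx> ?y" using star_eqv[OF eqs(1)] by (simp add: star_mult)
  ultimately have uy: "?u * ?y \<approx> ?y" by (rule eqv_trans)
  have "lpa_eq V E s r (fmul (fstar c x) u) (fstar c x)" "lpa_eq V E s r (fmul u (fstar c x)) (fstar c x)"
    using yu uy by (simp_all add: lpa_eq_iff Ser)
  then show "lpa_eq V E s r (fmul (fstar c x) x) u"
    using assms fa fa_y rels unfolding lpa_directly_finite_def by blast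
qed

end

section \<open>Cycles with exits\<close>

context graph
begin

lemma rpath_rev:
  "es \<noteq> [] \<Longrightarrow> set es \<subseteq> E \<Longrightarrow> successively (\<lambda>a b. r a = s b) es \<Longrightarrow>
    rpath (rev es) (r (last es)) \<and> start (rev es) (r (last es)) = s (hd es)"
  by (induction es rule: list_nonempty_induct) (auto simp: successively_Cons)

text \<open>The exit may leave from any vertex of the cycle, so the base point has to be moved
  there.\<close>

lemma cycle_rotate:
  assumes "is_cycle E s r es" "e \<in> set es"
  shows "\<exists>ps. closed_walk ps \<and> hd ps = e"
proof -
  obtain as bs where es: "es = as @ e # bs" using assms(2) by (meson split_list)
  have succ: "successively (\<lambda>a b. r a = s b) es"
    using assms(1) by (simp add: is_cycle_def successively_conv_nth)
  have E: "set es \<subseteq> E" and last: "r (last es) = s (hd es)"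
    using assms(1) unfolding is_cycle_def by simp_all
  have parts: "successively (\<lambda>a b. r a = s b) as" "successively (\<lambda>a b. r a = s b) (e # bs)"
    "as \<noteq> [] \<Longrightarrow> r (last as) = s e"
    using succ by (auto simp: es successively_append_iff)
  have "closed_walk (e # bs @ as)"
  proof (cases "as = []")
    case True
    then show ?thesis using succ E last by (simp add: closed_walk_def es)
  next
    case False
    then have "r (last (e # bs)) = s (hd as)" using last by (simp add: es)
    then have "successively (\<lambda>a b. r a = s b) ((e # bs) @ as)"
      using parts False by (simp only: successively_append_iff) simp
    then show ?thesis using E parts(3)[OF False] False by (auto simp: closed_walk_def es)
  qed
  then show ?thesis by (intro exI[of _ "e # bs @ as"]) simp
qed

end

context lpa_involution
begin

text \<open>(CK1) cancels from the middle outwards. The innermost pair belongs to the first edge of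
  the path, which is stored last; hence the induction from the right.\<close>

lemma ghost_real_path:
  "rpath p v \<Longrightarrow> v \<in> V \<Longrightarrow> mon (tword [] v p @ map GE (rev p) @ [GV v]) \<approx> mon [GV v]"
proof (induction p rule: rev_induct)
  case Nil
  then show ?case using rel_V[of v v] by (simp add: tword_def)
next
  case (snoc e p)
  then have e: "e \<in> E" "r e = start p v" "rpath p v" by auto
  have ok: "gens_ok (tword [] v p)" "gens_ok (map GE (rev p) @ [GV v])"
    using gens_ok_tword[of "[]" v p] e snoc.prems rpath_subset[of p v] by auto
  have "mon [GG e, GE e] \<approx> mon [GV (start p v)]" using rel_CK1[of e e] e by simp
  from mon_replace_word[OF this ok]
  have "mon (tword [] v (p @ [e]) @ map GE (rev (p @ [e])) @ [GV v])
      \<approx> mon (tword [] v p @ GV (start p v) # map GE (rev p) @ [GV v])"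
    by (simp add: tword_def)
  also have "\<dots> \<approx> mon (tword [] v p @ map GE (rev p) @ [GV v])"
    using eqv_sym[OF tword_start_append[of "[]" v p]] e snoc.prems ok by simp
  also have "\<dots> \<approx> mon [GV v]" using snoc e by simp
  finally show ?case .
qed

lemma finite_imp_no_exit:
  assumes "lpa_finite c V E s r"
  shows "no_exit V E s r"
  unfolding no_exit_def
proof (intro allI impI ballI, rule ccontr)
  fix es v assume cycle: "is_cycle E s r es" and "v \<in> s ` set es"
    and nex: "\<not> (\<exists>!e. e \<in> E \<and> s e = v)"
  then obtain e where e: "e \<in> set es" "s e = v" by blast
  have eE: "e \<in> E" using e cycle by (auto simp: is_cycle_def)
  obtain f where f: "f \<in> E" "s f = v" "f \<noteq> e" using nex eE e(2) by blast
  have vV: "v \<in> V" using source[OF eE] e by simp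
  obtain ps where ps: "closed_walk ps" "hd ps = e" using cycle_rotate[OF cycle e(1)] by blast
  define p where "p = rev ps"
  have p: "rpath p v" "start p v = v"
    using rpath_rev[of ps] ps e unfolding closed_walk_def p_def by auto
  \<comment> \<open>\<open>e\<close> is the first edge of the path, so p^* ends in e^* and is killed
    by \<open>f\<close> on its right.\<close>
  obtain q where q: "p = q @ [e]"
    using ps unfolding closed_walk_def p_def by (cases ps) auto
  let ?x = "mon (tword [] v p) :: ('v, 'e, 'k) ser" and ?u = "mon [GV v] :: ('v, 'e, 'k) ser"
  have star: "star c ?x = mon (tword p v [])"
    by (simp add: rstar_def tword_def rev_map comp_def)
  have ok: "gens_ok (tword [] v p)" "gens_ok (tword p v [])" "gens_ok (map GG p)"
    using gens_ok_tword p vV rpath_subset[OF p(1)] by auto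
  have word_ok: "word_ok V E (tword [] v p)" "word_ok V E [GV v]"
    using ok(1) vV by (auto simp: word_ok_def gens_ok_def tword_def gen_ok_def)
  have A: "?x \<in> alg" "?u \<in> alg"
    using word_ok by (auto simp: alg_iff supp_simps)
  have vv: "mon [GV v, GV v] \<approx> mon [GV v]" using rel_V[of v v] vV by simp
  have "?u * ?u \<approx> ?u" using vv by simp
  moreover have "?x * ?u \<approx> ?x" using tword_start[of "[]" v p] p vV by simp
  moreover have "?u * ?x \<approx> ?x"
    using mon_replace_word[OF vv, of "[]" "map GG p"] ok by (simp add: tword_def)
  moreover have "?x * star c ?x \<approx> ?u"
  proof -
    have "?x * star c ?x = mon (tword [] v p @ map GE (rev p) @ [GV v])"
      unfolding star by (simp add: tword_def)
    then show ?thesis using ghost_real_path[OF p(1) vV] by simp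
  qed
  moreover have "coeff ?x \<in> fa_carrier V E" "coeff ?u \<in> fa_carrier V E"
    using A unfolding alg_def by auto
  moreover have "Ser (fstar c (coeff ?x)) = star c ?x" by (simp add: star_def)
  moreover have "Ser (fmul a b) = Ser a * Ser b" for a b :: "('v, 'e, 'k) fa"
    by (simp add: times_ser_def)
  ultimately have "star c ?x * ?x \<approx> ?u"
    using assms[unfolded lpa_finite_def, rule_format, of "coeff ?x" "coeff ?u"]
    by (simp only: lpa_eq_iff Ser_coeff)
  then have "mon (tword p v [] @ tword [] v p) \<approx> mon [GV v]" unfolding star by simp
  from eqv_right[OF this mon_alg1[of "[GE f]"]] f
  have 1: "mon ((tword p v [] @ tword [] v p) @ [GE f]) \<approx> mon [GV v, GE f]" by simp
  have 2: "mon [GV v, GE f] \<approx> mon [GE f]" using rel_E1s[OF f(1)] f by simp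
  have 3: "mon ((tword p v [] @ tword [] v p) @ [GE f]) \<approx> 0"
  proof -
    have "mon [GG e, GE f] \<approx> 0" using rel_CK1[OF eE f(1)] f by simp
    from mon_replace_0[OF this, of "tword p v [] @ tword [] v q" "[]"] show ?thesis
      using ok by (simp add: tword_def q)
  qed
  have "mon [GE f] \<approx> 0" by (rule eqv_trans[OF eqv_sym[OF eqv_trans[OF 1 2]] 3])
  from eqv_left[OF this mon_alg1[of "[GG f]"]] f have 4: "mon [GG f, GE f] \<approx> 0" by simp
  have 5: "mon [GG f, GE f] \<approx> mon [GV (r f)]" using rel_CK1[of f f] f by simp
  have "mon [GV (r f)] \<approx> 0" by (rule eqv_trans[OF eqv_sym[OF 5] 4])
  then show False using vertex_not_in_ideal by (simp add: eqv_0_iff)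
qed

end

context no_exit_lpa
begin

lemma lpa_directly_finite: "lpa_directly_finite V E s r TYPE('k)"
  unfolding lpa_directly_finite_def
proof (intro ballI impI, elim conjE)
  fix x y u :: "('v, 'e, 'k) fa"
  assume "x \<in> fa_carrier V E" "y \<in> fa_carrier V E" "u \<in> fa_carrier V E"
    and "lpa_eq V E s r (fmul u u) u" "lpa_eq V E s r (fmul x u) x" "lpa_eq V E s r (fmul u x) x"
      "lpa_eq V E s r (fmul y u) y" "lpa_eq V E s r (fmul u y) y" "lpa_eq V E s r (fmul x y) u"
  moreover have "Ser (fmul a b) = Ser a * Ser b" for a b :: "('v, 'e, 'k) fa"
    by (simp add: times_ser_def)
  ultimately show "lpa_eq V E s r (fmul y x) u"
    using directly_finite[of "Ser x" "Ser y" "Ser u"] by (simp add: lpa_eq_iff alg_def)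
qed

end

theorem theorem4p12:
  fixes V :: "'v set" and E :: "'e set" and s r :: "'e \<Rightarrow> 'v"
    and c :: "'k::field \<Rightarrow> 'k"
  assumes "s ` E \<subseteq> V" and "r ` E \<subseteq> V" and "field_involution c"
  shows "(lpa_directly_finite V E s r TYPE('k) \<longleftrightarrow> lpa_finite c V E s r)
       \<and> (lpa_finite c V E s r \<longleftrightarrow> no_exit V E s r)"
proof -
  interpret lpa_involution V E s r "TYPE('k)" c
    using assms by unfold_locales auto
  have "lpa_directly_finite V E s r TYPE('k)" if "no_exit V E s r"
  proof -
    interpret no_exit_lpa V E s r "TYPE('k)"
      using that by unfold_locales
    show ?thesis by (rule lpa_directly_finite)
  qed
  then show ?thesis
    using directly_finite_imp_finite finite_imp_no_exit by blast
qed

end
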